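(* Let $(S,\rho)$ be a finitely correlated, fully coisometric representation of a $C^*$-correspondence $E$ on a Hilbert space $\mathcal{H}$. Let $\mathfrak{S}$ be the unital WOT-closed algebra generated by $(S,\rho)$ and let $\mathcal{V}$ be a finite dimensional $\mathfrak{S}^*$-invariant subspace of $\mathcal{H}$ such that $(S,\rho)$ is the minimal isometric dilation of the representation $(P_{\mathcal{V}}S(\cdot)|_{\mathcal{V}},\rho(\cdot)|_{\mathcal{V}})$. If $\mathcal{M}$ is a non-zero $\mathfrak{S}^*$-invariant subspace of $\mathcal{H}$, then $\mathcal{M}\cap\mathcal{V}$ is non-trivial, i.e. $\mathcal M\cap\mathcal V\ne\{0\}$.
   Context: Conventions. All $C^*$-algebras and their representations on Hilbert spaces are unital; subspaces are closed. A $C^*$-correspondence $E$ over $\mathcal A$ is a right Hilbert $C^*$-module over $\mathcal A$ ($\mathcal A$-valued inner product conjugate linear in the first variable) with a left action of $\mathcal A$ given by a $*$-homomorphism $\varphi:\mathcal A\to\mathcal L(E)$ into the adjointable operators. A representation $(A,\sigma)$ of $E$ on a Hilbert space $\mathcal V$ is a completely contractive linear map $A:E\to\mathcal B(\mathcal V)$ and a unital representation $\sigma$ of $\mathcal A$ on $\mathcal V$ with $A(a\xi b)=\sigma(a)A(\xi)\sigma(b)$. $E\otimes_\sigma\mathcal V$ is the Hausdorff completion of the algebraic tensor product with respect to $\langle\xi_1\otimes h_1,\xi_2\otimes h_2\rangle=\langle h_1,\sigma(\langle\xi_1,\xi_2\rangle)h_2\rangle$, and $\tilde A:E\otimes_\sigma\mathcal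 V\to\mathcal V$ is the contraction $\tilde A(\xi\otimes h)=A(\xi)h$. $(A,\sigma)$ is isometric if $A(\xi)^*A(\eta)=\sigma(\langle\xi,\eta\rangle)$ for all $\xi,\eta$ (equivalently $\tilde A$ is an isometry), and fully coisometric if $\tilde A\tilde A^*=I$. $E^n$ is the $n$-fold interior tensor product of $E$ with itself ($E^0=\mathcal A$), and $\tilde A_n:E^n\otimes_\sigma\mathcal V\to\mathcal V$ is $\tilde A_n(\xi_1\otimes\cdots\otimes\xi_n\otimes h)=A(\xi_1)\cdots A(\xi_n)h$. A representation $(S,\rho)$ on $\mathcal H\supseteq\mathcal V$ is a dilation of $(A,\sigma)$ if $\mathcal V$ reduces $\rho$ with $\rho(a)|_{\mathcal V}=\sigma(a)$, $\mathcal V^\perp$ is invariant under every $S(\xi)$, and $P_{\mathcal V}S(\xi)|_{\mathcal V}=A(\xi)$. It is an isometric dilation if $(S,\rho)$ is isometric, and minimal if $\mathcal H=\bigvee_{n\ge0}\tilde S_n(E^n\otimes\mathcal V)$. An isometric representation is finitely correlated if it is the minimal isometric dilation of a representation on a non-zero finite dimensional subspace. The unital WOT-closed algebra generated by $(S,\rho)$ is the weak-operator closure of the algebra generated by $I$, all $S(\xi)$ and all $\rho(a)$; $\mathfrak S^*=\{T^*:T\in\mathfrak S\}$. *)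

theory Defs
  imports "HOL-Analysis.Analysis" "HOL-Library.Poly_Mapping"
begin

section \<open>Complex Hilbert spaces\<close>

class complex_normed_vector = real_normed_vector +
  fixes scaleC :: "complex \<Rightarrow> 'a \<Rightarrow> 'a" (infixr "*\<^sub>C" 75)
  assumes scaleC_add_right: "c *\<^sub>C (x + y) = c *\<^sub>C x + c *\<^sub>C y"
    and scaleC_add_left: "(c + d) *\<^sub>C x = c *\<^sub>C x + d *\<^sub>C x"
    and scaleC_scaleC: "c *\<^sub>C d *\<^sub>C x = (c * d) *\<^sub>C x"
    and scaleC_of_real: "complex_of_real r *\<^sub>C x = r *\<^sub>R x"
    and norm_scaleC: "norm (c *\<^sub>C x) = cmod c * norm x"

lemma vector_space_scaleC:
  "vector_space ((*\<^sub>C) :: complex \<Rightarrow> 'a::complex_normed_vector \<Rightarrow> 'a)"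
  by unfold_locales
    (simp_all add: scaleC_add_right scaleC_add_left scaleC_scaleC
      scaleC_of_real[of 1, simplified])

abbreviation csubspace :: "'a::complex_normed_vector set \<Rightarrow> bool" where
  "csubspace \<equiv> module.subspace (*\<^sub>C)"

abbreviation cspan :: "'a::complex_normed_vector set \<Rightarrow> 'a set" where
  "cspan \<equiv> module.span (*\<^sub>C)"

definition closed_csubspace :: "'a::complex_normed_vector set \<Rightarrow> bool" where
  "closed_csubspace V \<longleftrightarrow> csubspace V \<and> closed V"

definition finite_dim :: "'a::complex_normed_vector set \<Rightarrow> bool" where
  "finite_dim V \<longleftrightarrow> (\<exists>B. finite B \<and> V = cspan B)"

text \<open>The inner product is conjugate linear in the first variable.\<close>

class chilbert_space = complex_normed_vector + complete_space +
  fixes cinner :: "'a \<Rightarrow> 'a \<Rightarrow> complex"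
  assumes cinner_commute: "cinner x y = cnj (cinner y x)"
    and cinner_add_right: "cinner x (y + z) = cinner x y + cinner x z"
    and cinner_scaleC_right: "cinner x (c *\<^sub>C y) = c * cinner x y"
    and cinner_self: "cinner x x = complex_of_real ((norm x)\<^sup>2)"

definition orth :: "'h::chilbert_space set \<Rightarrow> 'h set" where
  "orth V = {x. \<forall>v\<in>V. cinner v x = 0}"

definition proj :: "'h::chilbert_space set \<Rightarrow> 'h \<Rightarrow> 'h" where
  "proj V h = (THE p. p \<in> V \<and> h - p \<in> orth V)"

text \<open>
  A Hilbert space \<open>\<V>\<close> is a closed subspace \<open>V\<close> of an ambient type, and an element of
  \<open>\<B>(\<V>)\<close> is a function on that type of which only the values on \<open>V\<close> matter.
\<close>

definition bounded_op :: "'h::chilbert_space set \<Rightarrow> ('h \<Rightarrow> 'h) \<Rightarrow> bool" where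
  "bounded_op V T \<longleftrightarrow>
     (\<forall>x\<in>V. T x \<in> V) \<and>
     (\<forall>x\<in>V. \<forall>y\<in>V. T (x + y) = T x + T y) \<and>
     (\<forall>c. \<forall>x\<in>V. T (c *\<^sub>C x) = c *\<^sub>C T x) \<and>
     (\<exists>C. \<forall>x\<in>V. norm (T x) \<le> C * norm x)"

text \<open>
  The adjoint of \<open>T : K \<rightarrow> \<H>\<close>, where \<open>K\<close> carries the inner product \<open>ipK\<close>; the domain may
  also be one of the completions constructed below.
\<close>

definition adjoint_op :: "'k set \<Rightarrow> ('k \<Rightarrow> 'k \<Rightarrow> complex) \<Rightarrow> ('k \<Rightarrow> 'h::chilbert_space) \<Rightarrow> 'h \<Rightarrow> 'k" where
  "adjoint_op K ipK T h = (THE z. z \<in> K \<and> (\<forall>w\<in>K. ipK w z = cinner (T w) h))"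

abbreviation adj_on :: "'h::chilbert_space set \<Rightarrow> ('h \<Rightarrow> 'h) \<Rightarrow> 'h \<Rightarrow> 'h" where
  "adj_on V \<equiv> adjoint_op V cinner"


section \<open>\<open>C\<^sup>*\<close>-algebras and \<open>C\<^sup>*\<close>-correspondences\<close>

text \<open>
  Unital \<open>C\<^sup>*\<close>-algebras.  The zero algebra is excluded; it has no unital representation on
  a non-zero Hilbert space.
\<close>

class cstar_algebra = complex_normed_vector + real_normed_algebra_1 + complete_space +
  fixes star :: "'a \<Rightarrow> 'a"
  assumes mult_scaleC_left: "(c *\<^sub>C a) * b = c *\<^sub>C (a * b)"
    and mult_scaleC_right: "a * (c *\<^sub>C b) = c *\<^sub>C (a * b)"
    and star_add: "star (a + b) = star a + star b"
    and star_scaleC: "star (c *\<^sub>C a) = cnj c *\<^sub>C star a"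
    and star_mult: "star (a * b) = star b * star a"
    and star_star: "star (star a) = a"
    and cstar_identity: "norm (star a * a) = (norm a)\<^sup>2"

definition positive_elem :: "'a::cstar_algebra \<Rightarrow> bool" where
  "positive_elem a \<longleftrightarrow> (\<exists>b. a = star b * b)"

record ('a, 'e) correspondence =
  ip :: "'e \<Rightarrow> 'e \<Rightarrow> 'a"
  ract :: "'e \<Rightarrow> 'a \<Rightarrow> 'e"
  lact :: "'a \<Rightarrow> 'e \<Rightarrow> 'e"

text \<open>
  The condition \<open>norm_ip\<close> makes the norm of the type that of the Hilbert module; completeness
  is imposed through the sort.  By \<open>ip_lact\<close> every \<open>\<phi>(a)\<close> is adjointable with
  \<open>\<phi>(a)\<^sup>* = \<phi>(a\<^sup>*)\<close>.  The left action is not assumed to be unital.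
\<close>

locale cstar_correspondence =
  fixes E :: "('a::cstar_algebra, 'e::{complex_normed_vector,complete_space}) correspondence"
  assumes ract_add: "ract E (\<xi> + \<eta>) a = ract E \<xi> a + ract E \<eta> a"
    and ract_add_scalar: "ract E \<xi> (a + b) = ract E \<xi> a + ract E \<xi> b"
    and ract_mult: "ract E (ract E \<xi> a) b = ract E \<xi> (a * b)"
    and ract_one: "ract E \<xi> 1 = \<xi>"
    and ract_scaleC: "ract E (c *\<^sub>C \<xi>) a = c *\<^sub>C ract E \<xi> a"
    and ract_scaleC_scalar: "ract E \<xi> (c *\<^sub>C a) = c *\<^sub>C ract E \<xi> a"
    and ip_add: "ip E \<xi> (\<eta> + \<zeta>) = ip E \<xi> \<eta> + ip E \<xi> \<zeta>"
    and ip_scaleC: "ip E \<xi> (c *\<^sub>C \<eta>) = c *\<^sub>C ip E \<xi> \<eta>"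
    and ip_ract: "ip E \<xi> (ract E \<eta> a) = ip E \<xi> \<eta> * a"
    and ip_star: "star (ip E \<xi> \<eta>) = ip E \<eta> \<xi>"
    and ip_positive: "positive_elem (ip E \<xi> \<xi>)"
    and norm_ip: "norm \<xi> = sqrt (norm (ip E \<xi> \<xi>))"
    and lact_add: "lact E (a + b) \<xi> = lact E a \<xi> + lact E b \<xi>"
    and lact_scaleC: "lact E (c *\<^sub>C a) \<xi> = c *\<^sub>C lact E a \<xi>"
    and lact_mult: "lact E (a * b) \<xi> = lact E a (lact E b \<xi>)"
    and ip_lact: "ip E (lact E a \<xi>) \<eta> = ip E \<xi> (lact E (star a) \<eta>)"


section \<open>Complete contractivity\<close>

text \<open>
  An \<open>n \<times> n\<close> matrix is a function of two indices \<open>< n\<close>.  The norm of \<open>M\<^sub>n(\<A>)\<close> is that of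
  \<open>\<L>(\<A>\<^sup>n)\<close>, with \<open>\<A>\<^sup>n\<close> the standard Hilbert \<open>\<A>\<close>-module; \<open>M\<^sub>n(E)\<close> has the norm of the
  Hilbert module over \<open>M\<^sub>n(\<A>)\<close> with inner product
  \<open>\<langle>\<xi>,\<eta>\<rangle>\<^sub>i\<^sub>j = \<Sum>\<^sub>k \<langle>\<xi>\<^sub>k\<^sub>i,\<eta>\<^sub>k\<^sub>j\<rangle>\<close>; and \<open>M\<^sub>n(\<B>(\<V>)) = \<B>(\<V>\<^sup>n)\<close>.
\<close>

definition alg_vec_norm :: "nat \<Rightarrow> (nat \<Rightarrow> 'a::cstar_algebra) \<Rightarrow> real" where
  "alg_vec_norm n b = sqrt (norm (\<Sum>i<n. star (b i) * b i))"

definition alg_matrix_norm :: "nat \<Rightarrow> (nat \<Rightarrow> nat \<Rightarrow> 'a::cstar_algebra) \<Rightarrow> real" where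
  "alg_matrix_norm n a =
     (SUP b\<in>{b. alg_vec_norm n b \<le> 1}. alg_vec_norm n (\<lambda>i. \<Sum>j<n. a i j * b j))"

definition mod_matrix_norm ::
  "('a::cstar_algebra, 'e) correspondence \<Rightarrow> nat \<Rightarrow> (nat \<Rightarrow> nat \<Rightarrow> 'e) \<Rightarrow> real" where
  "mod_matrix_norm E n \<xi> =
     sqrt (alg_matrix_norm n (\<lambda>i j. \<Sum>k<n. ip E (\<xi> k i) (\<xi> k j)))"

definition op_matrix_norm ::
  "'h::chilbert_space set \<Rightarrow> nat \<Rightarrow> (nat \<Rightarrow> nat \<Rightarrow> 'h \<Rightarrow> 'h) \<Rightarrow> real" where
  "op_matrix_norm V n T =
     (SUP h\<in>{h. (\<forall>j<n. h j \<in> V) \<and> (\<Sum>j<n. (norm (h j))\<^sup>2) \<le> 1}.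
        sqrt (\<Sum>i<n. (norm (\<Sum>j<n. T i j (h j)))\<^sup>2))"

definition completely_contractive ::
  "('a::cstar_algebra, 'e) correspondence \<Rightarrow> 'h::chilbert_space set \<Rightarrow> ('e \<Rightarrow> 'h \<Rightarrow> 'h) \<Rightarrow> bool" where
  "completely_contractive E V A \<longleftrightarrow>
     (\<forall>n \<xi>. op_matrix_norm V n (\<lambda>i j. A (\<xi> i j)) \<le> mod_matrix_norm E n \<xi>)"


section \<open>Representations\<close>

definition unital_star_rep :: "'h::chilbert_space set \<Rightarrow> ('a::cstar_algebra \<Rightarrow> 'h \<Rightarrow> 'h) \<Rightarrow> bool" where
  "unital_star_rep V \<sigma> \<longleftrightarrow>
     (\<forall>a. bounded_op V (\<sigma> a)) \<and>
     (\<forall>a b. \<forall>h\<in>V. \<sigma> (a + b) h = \<sigma> a h + \<sigma> b h) \<and>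
     (\<forall>c a. \<forall>h\<in>V. \<sigma> (c *\<^sub>C a) h = c *\<^sub>C \<sigma> a h) \<and>
     (\<forall>a b. \<forall>h\<in>V. \<sigma> (a * b) h = \<sigma> a (\<sigma> b h)) \<and>
     (\<forall>a. \<forall>h\<in>V. \<sigma> (star a) h = adj_on V (\<sigma> a) h) \<and>
     (\<forall>h\<in>V. \<sigma> 1 h = h)"

definition representation ::
  "('a::cstar_algebra, 'e::complex_normed_vector) correspondence \<Rightarrow> 'h::chilbert_space set \<Rightarrow>
   ('e \<Rightarrow> 'h \<Rightarrow> 'h) \<Rightarrow> ('a \<Rightarrow> 'h \<Rightarrow> 'h) \<Rightarrow> bool" where
  "representation E V A \<sigma> \<longleftrightarrow>
     closed_csubspace V \<and>
     unital_star_rep V \<sigma> \<and>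
     (\<forall>\<xi>. bounded_op V (A \<xi>)) \<and>
     (\<forall>\<xi> \<eta>. \<forall>h\<in>V. A (\<xi> + \<eta>) h = A \<xi> h + A \<eta> h) \<and>
     (\<forall>c \<xi>. \<forall>h\<in>V. A (c *\<^sub>C \<xi>) h = c *\<^sub>C A \<xi> h) \<and>
     completely_contractive E V A \<and>
     (\<forall>a \<xi> b. \<forall>h\<in>V. A (lact E a (ract E \<xi> b)) h = \<sigma> a (A \<xi> (\<sigma> b h)))"

definition isometric ::
  "('a::cstar_algebra, 'e::complex_normed_vector) correspondence \<Rightarrow> 'h::chilbert_space set \<Rightarrow>
   ('e \<Rightarrow> 'h \<Rightarrow> 'h) \<Rightarrow> ('a \<Rightarrow> 'h \<Rightarrow> 'h) \<Rightarrow> bool" where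
  "isometric E V A \<sigma> \<longleftrightarrow>
     representation E V A \<sigma> \<and>
     (\<forall>\<xi> \<eta>. \<forall>h\<in>V. adj_on V (A \<xi>) (A \<eta> h) = \<sigma> (ip E \<xi> \<eta>) h)"


section \<open>Hausdorff completion\<close>

text \<open>
  The Hausdorff completion of \<open>X\<close> with respect to a positive semidefinite form \<open>s\<close>: Cauchy
  sequences modulo sequences tending to zero.
\<close>

definition semi_norm :: "('x \<Rightarrow> 'x \<Rightarrow> complex) \<Rightarrow> 'x \<Rightarrow> real" where
  "semi_norm s x = sqrt (Re (s x x))"

definition cauchy_seqs :: "'x::ab_group_add set \<Rightarrow> ('x \<Rightarrow> 'x \<Rightarrow> complex) \<Rightarrow> (nat \<Rightarrow> 'x) set" where
  "cauchy_seqs X s = {x. (\<forall>m. x m \<in> X) \<and>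
     (\<forall>e>0. \<exists>N. \<forall>m\<ge>N. \<forall>n\<ge>N. semi_norm s (x m - x n) < e)}"

definition null_rel ::
  "'x::ab_group_add set \<Rightarrow> ('x \<Rightarrow> 'x \<Rightarrow> complex) \<Rightarrow> ((nat \<Rightarrow> 'x) \<times> (nat \<Rightarrow> 'x)) set" where
  "null_rel X s = {(x, y). x \<in> cauchy_seqs X s \<and> y \<in> cauchy_seqs X s \<and>
     (\<lambda>m. semi_norm s (x m - y m)) \<longlonglongrightarrow> 0}"

definition completion :: "'x::ab_group_add set \<Rightarrow> ('x \<Rightarrow> 'x \<Rightarrow> complex) \<Rightarrow> (nat \<Rightarrow> 'x) set set" where
  "completion X s = cauchy_seqs X s // null_rel X s"

definition completion_ip ::
  "('x \<Rightarrow> 'x \<Rightarrow> complex) \<Rightarrow> (nat \<Rightarrow> 'x) set \<Rightarrow> (nat \<Rightarrow> 'x) set \<Rightarrow> complex" where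
  "completion_ip s z w = (THE c. \<forall>x\<in>z. \<forall>y\<in>w. (\<lambda>m. s (x m) (y m)) \<longlonglongrightarrow> c)"

definition extension :: "('x \<Rightarrow> 'h::topological_space) \<Rightarrow> (nat \<Rightarrow> 'x) set \<Rightarrow> 'h" where
  "extension f z = (THE v. \<forall>x\<in>z. (\<lambda>m. f (x m)) \<longlonglongrightarrow> v)"


section \<open>The spaces \<open>E\<^sup>n \<otimes>\<^sub>\<sigma> \<V>\<close> and the maps \<open>A\<^sub>n\<close>\<close>

text \<open>
  A list \<open>[\<xi>\<^sub>1, \<dots>, \<xi>\<^sub>n]\<close> stands for \<open>\<xi>\<^sub>1 \<otimes> \<dots> \<otimes> \<xi>\<^sub>n \<in> E\<^sup>n\<close>, and \<open>word_ip\<close> is the inner product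
  of the interior tensor product, determined by
  \<open>\<langle>\<xi> \<otimes> x, \<eta> \<otimes> y\<rangle> = \<langle>x, \<phi>(\<langle>\<xi>,\<eta>\<rangle>) y\<rangle>\<close>.  The empty list is the unit of \<open>E\<^sup>0 = \<A>\<close>.  The last
  equation only concerns lists of different lengths and is never used.
\<close>

fun word_ip :: "('a::cstar_algebra, 'e) correspondence \<Rightarrow> 'e list \<Rightarrow> 'e list \<Rightarrow> 'a" where
  "word_ip E [] [] = 1"
| "word_ip E [\<xi>] [\<eta>] = ip E \<xi> \<eta>"
| "word_ip E (\<xi> # \<xi>' # \<xi>s) (\<eta> # \<eta>' # \<eta>s) =
     word_ip E (\<xi>' # \<xi>s) (lact E (ip E \<xi> \<eta>) \<eta>' # \<eta>s)"
| "word_ip E _ _ = 0"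

text \<open>
  \<open>E\<^sup>n \<otimes>\<^sub>\<sigma> \<V>\<close> is the Hausdorff completion of the free vector space on the symbols
  \<open>\<xi>\<^sub>1 \<otimes> \<dots> \<otimes> \<xi>\<^sub>n \<otimes> h\<close>; the multilinearity relations lie in the kernel of the form, so the
  algebraic tensor product need not be formed first.  For \<open>n = 0\<close> the elements
  \<open>a \<otimes> h = 1 \<otimes> \<sigma>(a)h\<close> of \<open>\<A> \<otimes>\<^sub>\<sigma> \<V>\<close> are all represented by pairs \<open>([], h)\<close>; likewise
  \<open>E\<^sup>n\<close> may be replaced by its dense subspace spanned by elementary tensors.
\<close>

type_synonym ('e, 'h) pretensor = "('e list \<times> 'h) \<Rightarrow>\<^sub>0 complex"

definition pretensors :: "'h set \<Rightarrow> nat \<Rightarrow> ('e, 'h) pretensor set" where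
  "pretensors V n = {x. Poly_Mapping.keys x \<subseteq> {\<xi>s. length \<xi>s = n} \<times> V}"

definition tensor_form ::
  "('a::cstar_algebra, 'e) correspondence \<Rightarrow> ('a \<Rightarrow> 'h::chilbert_space \<Rightarrow> 'h) \<Rightarrow>
   ('e, 'h) pretensor \<Rightarrow> ('e, 'h) pretensor \<Rightarrow> complex" where
  "tensor_form E \<sigma> x y =
     (\<Sum>(\<xi>s, h)\<in>Poly_Mapping.keys x. \<Sum>(\<eta>s, k)\<in>Poly_Mapping.keys y.
        cnj (Poly_Mapping.lookup x (\<xi>s, h)) * Poly_Mapping.lookup y (\<eta>s, k) *
        cinner h (\<sigma> (word_ip E \<xi>s \<eta>s) k))"

definition tensor_space ::
  "('a::cstar_algebra, 'e) correspondence \<Rightarrow> 'h::chilbert_space set \<Rightarrow> ('a \<Rightarrow> 'h \<Rightarrow> 'h) \<Rightarrow> nat \<Rightarrow>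
   (nat \<Rightarrow> ('e, 'h) pretensor) set set" where
  "tensor_space E V \<sigma> n = completion (pretensors V n) (tensor_form E \<sigma>)"

abbreviation tensor_ip ::
  "('a::cstar_algebra, 'e) correspondence \<Rightarrow> ('a \<Rightarrow> 'h::chilbert_space \<Rightarrow> 'h) \<Rightarrow>
   (nat \<Rightarrow> ('e, 'h) pretensor) set \<Rightarrow> (nat \<Rightarrow> ('e, 'h) pretensor) set \<Rightarrow> complex" where
  "tensor_ip E \<sigma> \<equiv> completion_ip (tensor_form E \<sigma>)"

definition pre_tilde ::
  "('e \<Rightarrow> 'h::chilbert_space \<Rightarrow> 'h) \<Rightarrow> ('e, 'h) pretensor \<Rightarrow> 'h" where
  "pre_tilde A x =
     (\<Sum>(\<xi>s, h)\<in>Poly_Mapping.keys x. Poly_Mapping.lookup x (\<xi>s, h) *\<^sub>C foldr A \<xi>s h)"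

text \<open>On \<open>tensor_space E V \<sigma> n\<close> this is the map \<open>A\<^sub>n\<close> with tilde.\<close>

definition tilde ::
  "('e \<Rightarrow> 'h::chilbert_space \<Rightarrow> 'h) \<Rightarrow> (nat \<Rightarrow> ('e, 'h) pretensor) set \<Rightarrow> 'h" where
  "tilde A = extension (pre_tilde A)"

definition fully_coisometric ::
  "('a::cstar_algebra, 'e::complex_normed_vector) correspondence \<Rightarrow> 'h::chilbert_space set \<Rightarrow>
   ('e \<Rightarrow> 'h \<Rightarrow> 'h) \<Rightarrow> ('a \<Rightarrow> 'h \<Rightarrow> 'h) \<Rightarrow> bool" where
  "fully_coisometric E V A \<sigma> \<longleftrightarrow>
     representation E V A \<sigma> \<and>
     (\<forall>h\<in>V. tilde A (adjoint_op (tensor_space E V \<sigma> 1) (tensor_ip E \<sigma>) (tilde A) h) = h)"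


section \<open>Dilations\<close>

text \<open>The dilation \<open>(S, \<rho>)\<close> acts on the whole type \<open>'h\<close>.\<close>

definition dilation ::
  "('a::cstar_algebra, 'e::complex_normed_vector) correspondence \<Rightarrow> 'h::chilbert_space set \<Rightarrow>
   ('e \<Rightarrow> 'h \<Rightarrow> 'h) \<Rightarrow> ('a \<Rightarrow> 'h \<Rightarrow> 'h) \<Rightarrow> ('e \<Rightarrow> 'h \<Rightarrow> 'h) \<Rightarrow> ('a \<Rightarrow> 'h \<Rightarrow> 'h) \<Rightarrow> bool" where
  "dilation E V A \<sigma> S \<rho> \<longleftrightarrow>
     representation E V A \<sigma> \<and>
     representation E UNIV S \<rho> \<and>
     (\<forall>a. \<rho> a ` V \<subseteq> V \<and> \<rho> a ` orth V \<subseteq> orth V) \<and>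
     (\<forall>a. \<forall>h\<in>V. \<rho> a h = \<sigma> a h) \<and>
     (\<forall>\<xi>. S \<xi> ` orth V \<subseteq> orth V) \<and>
     (\<forall>\<xi>. \<forall>h\<in>V. proj V (S \<xi> h) = A \<xi> h)"

definition minimal_isometric_dilation ::
  "('a::cstar_algebra, 'e::complex_normed_vector) correspondence \<Rightarrow> 'h::chilbert_space set \<Rightarrow>
   ('e \<Rightarrow> 'h \<Rightarrow> 'h) \<Rightarrow> ('a \<Rightarrow> 'h \<Rightarrow> 'h) \<Rightarrow> ('e \<Rightarrow> 'h \<Rightarrow> 'h) \<Rightarrow> ('a \<Rightarrow> 'h \<Rightarrow> 'h) \<Rightarrow> bool" where
  "minimal_isometric_dilation E V A \<sigma> S \<rho> \<longleftrightarrow>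
     dilation E V A \<sigma> S \<rho> \<and>
     isometric E UNIV S \<rho> \<and>
     closure (cspan (\<Union>n. tilde S ` tensor_space E V \<rho> n)) = UNIV"

definition finitely_correlated ::
  "('a::cstar_algebra, 'e::complex_normed_vector) correspondence \<Rightarrow>
   ('e \<Rightarrow> 'h::chilbert_space \<Rightarrow> 'h) \<Rightarrow> ('a \<Rightarrow> 'h \<Rightarrow> 'h) \<Rightarrow> bool" where
  "finitely_correlated E S \<rho> \<longleftrightarrow>
     isometric E UNIV S \<rho> \<and>
     (\<exists>W A \<sigma>. closed_csubspace W \<and> finite_dim W \<and> W \<noteq> {0} \<and>
        minimal_isometric_dilation E W A \<sigma> S \<rho>)"


section \<open>The unital WOT-closed algebra of a representation\<close>

inductive_set generated_algebra ::
  "('e \<Rightarrow> 'h::chilbert_space \<Rightarrow> 'h) \<Rightarrow> ('a \<Rightarrow> 'h \<Rightarrow> 'h) \<Rightarrow> ('h \<Rightarrow> 'h) set"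
  for S :: "'e \<Rightarrow> 'h \<Rightarrow> 'h" and \<rho> :: "'a \<Rightarrow> 'h \<Rightarrow> 'h" where
  gen_id: "id \<in> generated_algebra S \<rho>"
| gen_S: "S \<xi> \<in> generated_algebra S \<rho>"
| gen_rho: "\<rho> a \<in> generated_algebra S \<rho>"
| gen_add: "T \<in> generated_algebra S \<rho> \<Longrightarrow> R \<in> generated_algebra S \<rho> \<Longrightarrow>
            (\<lambda>h. T h + R h) \<in> generated_algebra S \<rho>"
| gen_scale: "T \<in> generated_algebra S \<rho> \<Longrightarrow> (\<lambda>h. c *\<^sub>C T h) \<in> generated_algebra S \<rho>"
| gen_comp: "T \<in> generated_algebra S \<rho> \<Longrightarrow> R \<in> generated_algebra S \<rho> \<Longrightarrow>
             T \<circ> R \<in> generated_algebra S \<rho>"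

text \<open>The coarsest topology on \<open>\<B>(\<H>)\<close> making every \<open>T \<mapsto> \<langle>y, T x\<rangle>\<close> continuous.\<close>

definition wot :: "('h::chilbert_space \<Rightarrow> 'h) topology" where
  "wot = pullback_topology {T. bounded_op UNIV T} (\<lambda>T (x, y). cinner y (T x))
           (product_topology (\<lambda>_. euclidean) UNIV)"

definition wot_algebra ::
  "('e \<Rightarrow> 'h::chilbert_space \<Rightarrow> 'h) \<Rightarrow> ('a \<Rightarrow> 'h \<Rightarrow> 'h) \<Rightarrow> ('h \<Rightarrow> 'h) set" where
  "wot_algebra S \<rho> = wot closure_of (generated_algebra S \<rho>)"

definition adjoints :: "('h::chilbert_space \<Rightarrow> 'h) set \<Rightarrow> ('h \<Rightarrow> 'h) set" where
  "adjoints \<SS> = adj_on UNIV ` \<SS>"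

definition invariant_under :: "('h \<Rightarrow> 'h) set \<Rightarrow> 'h set \<Rightarrow> bool" where
  "invariant_under \<TT> M \<longleftrightarrow> (\<forall>T\<in>\<TT>. T ` M \<subseteq> M)"

end

theory Submission
  imports Defs
begin

text \<open>
  Suppose that \<open>M \<inter> V = {0}\<close>.  As \<open>V\<close> is finite dimensional, its unit sphere is compact, so the
  two subspaces meet at a positive angle: there is \<open>c < 1\<close> with \<open>\<parallel>P\<^sub>M v\<parallel> \<le> c \<parallel>v\<parallel>\<close> for all
  \<open>v \<in> V\<close> (\<open>finite_dim_positive_angle\<close>).

  This angle survives tensoring with \<open>E\<^sup>n\<close>.  Write \<open>V\<^sub>n\<close> for the span of the vectors
  \<open>S(\<xi>\<^sub>1) \<cdots> S(\<xi>\<^sub>n) v\<close> with \<open>v \<in> V\<close>, which is the image of \<open>E\<^sup>n \<otimes> V\<close> in \<open>\<H>\<close>.  Both \<open>V\<close> and \<open>M\<close>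
  reduce \<open>\<rho>\<close>, so \<open>P\<^sub>V\<close> and \<open>P\<^sub>M\<close> commute with \<open>\<rho>\<close> and \<open>I \<otimes> P\<^sub>V\<close>, \<open>I \<otimes> P\<^sub>M\<close> make sense on
  \<open>E\<^sup>n \<otimes> \<H>\<close>.  The orthogonal complement of \<open>M\<close> is invariant under every \<open>S(\<xi>)\<close>, so for \<open>m \<in> M\<close> and
  \<open>y = \<Sum> S\<^sub>w v\<^sub>w \<in> V\<^sub>n\<close>, where \<open>S\<^sub>w = S(\<xi>\<^sub>1) \<cdots> S(\<xi>\<^sub>n)\<close>, the inner product \<open>\<langle>m, y\<rangle>\<close> does not change when
  each \<open>v\<^sub>w\<close> is replaced by \<open>P\<^sub>M v\<^sub>w\<close>, and
  \<open>\<parallel>\<Sum> S\<^sub>w P\<^sub>M v\<^sub>w\<parallel>\<^sup>2 = \<langle>y, \<Sum> S\<^sub>w P\<^sub>V P\<^sub>M P\<^sub>V v\<^sub>w\<rangle> \<le> c \<parallel>y\<parallel>\<^sup>2\<close>.  Hence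
  \<open>|\<langle>m, y\<rangle>| \<le> \<surd>c \<parallel>m\<parallel> \<parallel>y\<parallel>\<close>, with a constant that does not depend on \<open>n\<close> (\<open>fiber_angle\<close>).

  On the other hand \<open>S\<close> is fully coisometric and the complement of \<open>V\<close> is \<open>S\<close>-invariant, which
  forces \<open>V\<close> into the closure of \<open>V\<^sub>1\<close>; the closures of the \<open>V\<^sub>n\<close> therefore increase
  (\<open>closure_fiber_mono\<close>), and by minimality their union is dense.  The inequality then holds for all
  \<open>y \<in> \<H>\<close>.  Taking \<open>y = m\<close> gives \<open>\<parallel>m\<parallel>\<^sup>2 \<le> \<surd>c \<parallel>m\<parallel>\<^sup>2\<close>, so \<open>M = {0}\<close> (\<open>coinvariant_intersection\<close>).

  The computations take place in \<open>\<H>\<close>: since \<open>S\<close> is isometric, the map with tilde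
  embeds the completion \<open>E\<^sup>n \<otimes> V\<close> isometrically in the closure of \<open>V\<^sub>n\<close>, and this is all that has to be
  known about the completion.
\<close>

section \<open>Projections and adjoints in complex Hilbert spaces\<close>

interpretation cvs: vector_space "(*\<^sub>C) :: complex \<Rightarrow> 'a::complex_normed_vector \<Rightarrow> 'a"
  by (rule vector_space_scaleC)

lemma cinner_add_left: "cinner (x + y) z = cinner x z + cinner y z"
  for x y z :: "'h::chilbert_space"
  by (metis cinner_commute cinner_add_right complex_cnj_add)

lemma cinner_scaleC_left: "cinner (c *\<^sub>C x) y = cnj c * cinner x y"
  for x y :: "'h::chilbert_space"
  by (metis cinner_commute cinner_scaleC_right complex_cnj_mult)

lemma cinner_Cauchy_Schwarz: "cmod (cinner x y) \<le> norm x * norm y"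
  for x y :: "'h::chilbert_space"
proof (cases "x = 0")
  case True
  have "cinner x y = cinner (0 *\<^sub>C x) y"
    using True by simp
  also have "\<dots> = 0"
    by (simp only: cinner_scaleC_left) simp
  finally show ?thesis
    by simp
next
  case False
  define t where "t = cinner x y / (norm x)\<^sup>2"
  have xx: "cinner x x \<noteq> 0"
    using False by (simp add: cinner_self)
  have split: "y = (y + (- t) *\<^sub>C x) + t *\<^sub>C x"
    by simp
  have orth: "cinner x (y + (- t) *\<^sub>C x) = 0"
    using xx by (simp add: cinner_add_right cinner_scaleC_right t_def cinner_self del: cvs.scale_minus_left)
  then have orth': "cinner (y + (- t) *\<^sub>C x) x = 0"
    by (metis cinner_commute complex_cnj_zero)
  have "cinner y y = cinner (y + (- t) *\<^sub>C x) (y + (- t) *\<^sub>C x) + cnj t * t * cinner x x"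
    by (subst (1 2) split)
      (simp only: cinner_add_right[of _ _ "t *\<^sub>C x"] cinner_add_left[of _ "t *\<^sub>C x"]
        cinner_scaleC_right[of _ t] cinner_scaleC_left[of t] orth orth', simp)
  moreover have "cnj t * t = complex_of_real ((cmod t)\<^sup>2)"
    by (simp only: complex_norm_square mult.commute)
  ultimately have "complex_of_real ((norm y)\<^sup>2) =
      complex_of_real ((norm (y + (- t) *\<^sub>C x))\<^sup>2 + (cmod t * norm x)\<^sup>2)"
    by (simp add: cinner_self power_mult_distrib del: cvs.scale_minus_left)
  then have "(cmod t * norm x)\<^sup>2 \<le> (norm y)\<^sup>2"
    by (simp only: of_real_eq_iff) simp
  then have "cmod t * norm x \<le> norm y"
    by (rule power2_le_imp_le) simp
  then have "cmod t * norm x * norm x \<le> norm y * norm x"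
    by (rule mult_right_mono) simp
  then show ?thesis
    using False by (simp add: t_def norm_divide norm_power power2_eq_square norm_mult mult.commute)
qed

interpretation cinner: bounded_bilinear "cinner :: 'h::chilbert_space \<Rightarrow> 'h \<Rightarrow> complex"
proof
  show "\<exists>K. \<forall>a b::'h. norm (cinner a b) \<le> norm a * norm b * K"
    using cinner_Cauchy_Schwarz by (intro exI[of _ 1]) auto
qed (simp_all add: cinner_add_left cinner_add_right cinner_scaleC_left cinner_scaleC_right
    scaleC_of_real[symmetric] scaleR_conv_of_real)

lemma norm_diff_power2:
  "(norm (x - y))\<^sup>2 = (norm x)\<^sup>2 + (norm y)\<^sup>2 - 2 * Re (cinner x y)"
  for x y :: "'h::chilbert_space"
proof -
  have "complex_of_real ((norm (x - y))\<^sup>2) = cinner x x + cinner y y - (cinner x y + cnj (cinner x y))"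
    using cinner_commute[of y x] unfolding cinner_self[symmetric]
    by (simp add: cinner.diff_left cinner.diff_right)
  also have "\<dots> = complex_of_real ((norm x)\<^sup>2 + (norm y)\<^sup>2 - 2 * Re (cinner x y))"
    by (simp add: cinner_self complex_add_cnj)
  finally show ?thesis
    using of_real_eq_iff by blast
qed

lemma closed_csubspaceD:
  assumes "closed_csubspace V"
  shows "0 \<in> V" "x \<in> V \<Longrightarrow> y \<in> V \<Longrightarrow> x + y \<in> V" "x \<in> V \<Longrightarrow> c *\<^sub>C x \<in> V"
    "x \<in> V \<Longrightarrow> y \<in> V \<Longrightarrow> x - y \<in> V" "x \<in> V \<Longrightarrow> r *\<^sub>R x \<in> V" "closed V"
  using assms unfolding closed_csubspace_def
  by (simp_all add: cvs.subspace_0 cvs.subspace_add cvs.subspace_scale cvs.subspace_diff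
      scaleC_of_real[symmetric])

lemma norm_add_power2:
  "(norm (x + y))\<^sup>2 = (norm x)\<^sup>2 + (norm y)\<^sup>2 + 2 * Re (cinner x y)"
  for x y :: "'h::chilbert_space"
  using norm_diff_power2[of x "- y"] by (simp add: cinner.minus_right)

text \<open>
  The parallelogram law, applied to a minimising sequence, bounds the distance of two of its members
  by how far they are from optimal; so the sequence is Cauchy.
\<close>

lemma nearest_point_exists:
  fixes h :: "'h::chilbert_space"
  assumes V: "closed_csubspace V"
  shows "\<exists>p\<in>V. \<forall>v\<in>V. norm (h - p) \<le> norm (h - v)"
proof -
  note V = closed_csubspaceD[OF V]
  define D where "D = (\<lambda>v. norm (h - v)) ` V"
  have bdd: "bdd_below D"
    by (auto simp: D_def intro: bdd_belowI[of _ 0])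
  have ne: "D \<noteq> {}"
    using V(1) by (auto simp: D_def)
  have lower: "Inf D \<le> norm (h - v)" if "v \<in> V" for v
    using that bdd by (auto simp: D_def intro: cInf_lower)
  have pos: "0 \<le> Inf D"
    using ne by (rule cInf_greatest) (auto simp: D_def)
  have "\<exists>v\<in>V. norm (h - v) < Inf D + 1 / Suc n" for n
    using cInf_lessD[OF ne, of "Inf D + 1 / Suc n"] by (auto simp: D_def)
  then obtain v where v: "\<And>n. v n \<in> V" "\<And>n. norm (h - v n) < Inf D + 1 / Suc n"
    by metis
  have lim: "(\<lambda>n. norm (h - v n)) \<longlonglongrightarrow> Inf D"
  proof (rule tendsto_sandwich)
    show "\<forall>\<^sub>F n in sequentially. Inf D \<le> norm (h - v n)"
      using lower v(1) by simp
    show "\<forall>\<^sub>F n in sequentially. norm (h - v n) \<le> Inf D + 1 / Suc n"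
      using v(2) less_imp_le by (intro always_eventually) blast
    show "(\<lambda>n. Inf D + 1 / Suc n) \<longlonglongrightarrow> Inf D"
      using tendsto_add[OF tendsto_const LIMSEQ_Suc[OF lim_1_over_n]] by simp
  qed simp
  have para: "(norm (v m - v n))\<^sup>2 \<le> 2 * (norm (h - v m))\<^sup>2 + 2 * (norm (h - v n))\<^sup>2 - 4 * (Inf D)\<^sup>2" for m n
  proof -
    \<comment> \<open>The midpoint of two members is a competitor in the infimum.\<close>
    have "(1/2) *\<^sub>R (v m + v n) \<in> V"
      by (intro V v)
    then have "Inf D \<le> norm (h - (1/2) *\<^sub>R (v m + v n))"
      by (rule lower)
    moreover have "(h - v m) + (h - v n) = 2 *\<^sub>R (h - (1/2) *\<^sub>R (v m + v n))"
      by (simp add: algebra_simps scaleR_2)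
    ultimately have "2 * Inf D \<le> norm ((h - v m) + (h - v n))"
      by simp
    then have "(2 * Inf D)\<^sup>2 \<le> (norm ((h - v m) + (h - v n)))\<^sup>2"
      using pos by (intro power_mono) auto
    moreover have "v m - v n = (h - v n) - (h - v m)"
      by simp
    ultimately show ?thesis
      using norm_add_power2[of "h - v n" "h - v m"] norm_diff_power2[of "h - v n" "h - v m"]
      by (simp add: power_mult_distrib add.commute)
  qed
  have "Cauchy v"
  proof (rule metric_CauchyI)
    fix e :: real
    assume "e > 0"
    have "(\<lambda>n. (norm (h - v n))\<^sup>2) \<longlonglongrightarrow> (Inf D)\<^sup>2"
      using lim by (intro tendsto_intros)
    moreover have "(Inf D)\<^sup>2 < (Inf D)\<^sup>2 + e\<^sup>2 / 4"
      using \<open>e > 0\<close> by simp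
    ultimately have "\<forall>\<^sub>F n in sequentially. (norm (h - v n))\<^sup>2 < (Inf D)\<^sup>2 + e\<^sup>2 / 4"
      by (rule order_tendstoD(2))
    then obtain N where N: "\<And>n. n \<ge> N \<Longrightarrow> (norm (h - v n))\<^sup>2 < (Inf D)\<^sup>2 + e\<^sup>2 / 4"
      by (auto simp: eventually_sequentially)
    have "dist (v m) (v n) < e" if "m \<ge> N" "n \<ge> N" for m n
    proof -
      have "(norm (v m - v n))\<^sup>2 < e\<^sup>2"
        using para[of m n] N[OF that(1)] N[OF that(2)] by linarith
      then show ?thesis
        using \<open>e > 0\<close> by (simp add: dist_norm power2_less_imp_less)
    qed
    then show "\<exists>N. \<forall>m\<ge>N. \<forall>n\<ge>N. dist (v m) (v n) < e"
      by blast
  qed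
  then obtain p where p: "v \<longlonglongrightarrow> p"
    using Cauchy_convergent by (auto simp: convergent_def)
  have "p \<in> V"
    using closed_sequentially[OF V(6)] v(1) p by blast
  moreover have "norm (h - p) = Inf D"
    using LIMSEQ_unique[OF lim tendsto_norm[OF tendsto_diff[OF tendsto_const p]]] by simp
  ultimately show ?thesis
    using lower by (intro bexI[of _ p]) simp_all
qed

text \<open>
  If the nearest point \<open>p\<close> left a residue \<open>h - p\<close> not orthogonal to \<open>v \<in> V\<close>, then moving \<open>p\<close> in the
  direction of \<open>v\<close> by the Fourier coefficient of the residue would bring it closer to \<open>h\<close>.
\<close>

lemma orthogonal_decomposition:
  fixes h :: "'h::chilbert_space"
  assumes V: "closed_csubspace V"
  shows "\<exists>!p. p \<in> V \<and> h - p \<in> orth V"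
proof -
  note VD = closed_csubspaceD[OF V]
  obtain p where p: "p \<in> V" "\<And>v. v \<in> V \<Longrightarrow> norm (h - p) \<le> norm (h - v)"
    using nearest_point_exists[OF V] by blast
  have "cinner v (h - p) = 0" if v: "v \<in> V" for v
  proof (rule ccontr)
    assume ne: "cinner v (h - p) \<noteq> 0"
    then have "v \<noteq> 0"
      by (auto simp: cinner.zero_left)
    define a where "a = cinner v (h - p)"
    define t where "t = a / (norm v)\<^sup>2"
    have "norm (h - p) \<le> norm (h - (p + t *\<^sub>C v))"
      by (intro p VD v)
    then have "(norm (h - p))\<^sup>2 \<le> (norm ((h - p) - t *\<^sub>C v))\<^sup>2"
      by (intro power_mono) (auto simp: algebra_simps)
    also have "\<dots> = (norm (h - p))\<^sup>2 + (norm (t *\<^sub>C v))\<^sup>2 - 2 * Re (cinner (h - p) (t *\<^sub>C v))"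
      by (rule norm_diff_power2)
    also have "cinner (h - p) (t *\<^sub>C v) = t * cnj a"
      by (metis cinner_scaleC_right cinner_commute a_def)
    also have "t * cnj a = complex_of_real ((cmod a)\<^sup>2 / (norm v)\<^sup>2)"
      by (simp only: t_def times_divide_eq_left complex_norm_square of_real_divide)
    also have "(norm (t *\<^sub>C v))\<^sup>2 = (cmod a)\<^sup>2 / (norm v)\<^sup>2"
      using \<open>v \<noteq> 0\<close> by (simp add: t_def norm_scaleC norm_divide norm_mult power2_eq_square field_simps)
    finally have "(cmod a)\<^sup>2 / (norm v)\<^sup>2 \<le> 0"
      by simp
    then show False
      using ne \<open>v \<noteq> 0\<close> by (simp add: divide_le_0_iff a_def power_le_zero_eq)
  qed
  then have orth: "h - p \<in> orth V"
    by (simp add: orth_def)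
  show ?thesis
  proof (rule ex1I)
    show "p \<in> V \<and> h - p \<in> orth V"
      using p(1) orth ..
    fix q
    assume q: "q \<in> V \<and> h - q \<in> orth V"
    have "q - p \<in> V"
      using q p(1) by (intro VD) auto
    then have "cinner (q - p) (h - p) = 0" "cinner (q - p) (h - q) = 0"
      using q orth unfolding orth_def by blast+
    then have "cinner (q - p) (q - p) = 0"
      by (simp add: cinner.diff_right)
    then show "q = p"
      by (simp add: cinner_self)
  qed
qed

lemma proj_in: "closed_csubspace V \<Longrightarrow> proj V h \<in> V"
  and proj_orth: "closed_csubspace V \<Longrightarrow> h - proj V h \<in> orth V"
proof -
  have "proj V h \<in> V \<and> h - proj V h \<in> orth V" if "closed_csubspace V"
    unfolding proj_def by (rule theI'[OF orthogonal_decomposition[OF that]])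
  then show "closed_csubspace V \<Longrightarrow> proj V h \<in> V"
    and "closed_csubspace V \<Longrightarrow> h - proj V h \<in> orth V"
    by simp_all
qed

lemma proj_unique: "closed_csubspace V \<Longrightarrow> p \<in> V \<Longrightarrow> h - p \<in> orth V \<Longrightarrow> proj V h = p"
  unfolding proj_def by (rule the1_equality[OF orthogonal_decomposition conjI])

lemma proj_ident: "closed_csubspace V \<Longrightarrow> h \<in> V \<Longrightarrow> proj V h = h"
  by (rule proj_unique) (auto simp: orth_def cinner.zero_right)

lemma proj_cinner:
  assumes "closed_csubspace V"
  shows "v \<in> V \<Longrightarrow> cinner v (proj V h) = cinner v h"
    and "v \<in> V \<Longrightarrow> cinner (proj V h) v = cinner h v"
proof -
  show *: "cinner v (proj V h) = cinner v h" if "v \<in> V"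
    using proj_orth[OF assms, of h] that by (auto simp: orth_def cinner.diff_right)
  show "cinner (proj V h) v = cinner h v" if "v \<in> V"
    using *[OF that] cinner_commute[of "proj V h" v] cinner_commute[of h v] by simp
qed

lemma proj_symmetric:
  assumes "closed_csubspace V"
  shows "cinner (proj V h) k = cinner h (proj V k)"
  using proj_cinner(1)[OF assms proj_in[OF assms, of h], of k]
    proj_cinner(2)[OF assms proj_in[OF assms, of k], of h] by simp

lemma orth_diff: "x \<in> orth V \<Longrightarrow> y \<in> orth V \<Longrightarrow> x - y \<in> orth V"
  and orth_scaleC: "x \<in> orth V \<Longrightarrow> c *\<^sub>C x \<in> orth V"
  by (simp_all add: orth_def cinner.diff_right cinner_scaleC_right)

lemma proj_diff:
  assumes "closed_csubspace V"
  shows "proj V (x - y) = proj V x - proj V y"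
proof (rule proj_unique[OF assms])
  show "proj V x - proj V y \<in> V"
    by (intro closed_csubspaceD[OF assms] proj_in[OF assms])
  show "x - y - (proj V x - proj V y) \<in> orth V"
    using orth_diff[OF proj_orth[OF assms, of x] proj_orth[OF assms, of y]]
    by (simp add: algebra_simps)
qed

lemma proj_scaleC:
  assumes "closed_csubspace V"
  shows "proj V (c *\<^sub>C x) = c *\<^sub>C proj V x"
proof (rule proj_unique[OF assms])
  show "c *\<^sub>C proj V x \<in> V"
    by (intro closed_csubspaceD[OF assms] proj_in[OF assms])
  show "c *\<^sub>C x - c *\<^sub>C proj V x \<in> orth V"
    using orth_scaleC[OF proj_orth[OF assms, of x]]
    by (simp add: cvs.scale_right_diff_distrib)
qed

lemma norm_proj_power2:
  assumes "closed_csubspace V"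
  shows "(norm h)\<^sup>2 = (norm (proj V h))\<^sup>2 + (norm (h - proj V h))\<^sup>2"
proof -
  have "cinner (proj V h) (h - proj V h) = 0"
    using proj_orth[OF assms, of h] proj_in[OF assms, of h] unfolding orth_def by blast
  then show ?thesis
    using norm_add_power2[of "proj V h" "h - proj V h"] by simp
qed

lemma norm_proj_le:
  assumes "closed_csubspace V"
  shows "norm (proj V h) \<le> norm h"
  by (rule power2_le_imp_le) (use norm_proj_power2[OF assms, of h] in simp_all)

lemma continuous_proj:
  assumes "closed_csubspace V"
  shows "continuous_on A (proj V)"
proof (rule continuous_onI)
  fix x e assume "(0::real) < e"
  have "dist (proj V x') (proj V x) \<le> dist x' x" for x'
    using norm_proj_le[OF assms, of "x' - x"] by (simp add: dist_norm proj_diff[OF assms])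
  then show "\<exists>d>0. \<forall>x'\<in>A. dist x' x < d \<longrightarrow> dist (proj V x') (proj V x) \<le> e"
    using \<open>0 < e\<close> by (intro exI[of _ e] conjI ballI impI) (auto intro: order_trans less_imp_le)
qed

lemma bounded_op_UNIV:
  assumes "bounded_op UNIV T"
  shows "T (x + y) = T x + T y" "T (c *\<^sub>C x) = c *\<^sub>C T x" "bounded_linear T"
proof -
  show add: "T (x + y) = T x + T y" and scale: "T (c *\<^sub>C x) = c *\<^sub>C T x" for x y c
    using assms by (simp_all add: bounded_op_def)
  obtain C where "\<And>x. norm (T x) \<le> C * norm x"
    using assms by (auto simp: bounded_op_def)
  then show "bounded_linear T"
    by (intro bounded_linear_intro[of _ C])
      (simp_all add: add scale scaleC_of_real[symmetric] mult.commute)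
qed

text \<open>
  The kernel of a non-zero functional has a one-dimensional orthogonal complement, and the
  representing vector is the right multiple of any non-zero vector \<open>u'\<close> in it.
\<close>

lemma Riesz_representation:
  fixes f :: "'h::chilbert_space \<Rightarrow> complex"
  assumes f: "bounded_linear f" and scale: "\<And>c x. f (c *\<^sub>C x) = c * f x"
  shows "\<exists>z. \<forall>w. f w = cinner z w"
proof (cases "\<forall>w. f w = 0")
  case True
  then show ?thesis
    by (intro exI[of _ 0]) (simp add: cinner.zero_left)
next
  case False
  then obtain u where u: "f u \<noteq> 0"
    by blast
  interpret f: bounded_linear f by (rule f)
  define N where "N = {w. f w = 0}"
  have N: "closed_csubspace N"
    unfolding closed_csubspace_def
  proof
    show "csubspace N"
      by (rule cvs.subspaceI) (auto simp: N_def f.zero f.add scale)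
    show "closed N"
      unfolding N_def by (intro closed_Collect_eq continuous_intros f.continuous_on)
  qed
  define u' where "u' = u - proj N u"
  have "f (proj N u) = 0"
    using proj_in[OF N, of u] by (simp add: N_def)
  then have fu': "f u' \<noteq> 0"
    using u by (simp add: u'_def f.diff)
  then have "u' \<noteq> 0"
    by (auto simp: f.zero)
  define z where "z = cnj (f u' / (norm u')\<^sup>2) *\<^sub>C u'"
  have "f w = cinner z w" for w
  proof -
    have "w - (f w / f u') *\<^sub>C u' \<in> N"
      using fu' by (simp add: N_def f.diff scale)
    then have "cinner (w - (f w / f u') *\<^sub>C u') u' = 0"
      using proj_orth[OF N, of u] by (simp add: orth_def u'_def)
    then have "cinner u' (w - (f w / f u') *\<^sub>C u') = 0"
      by (metis cinner_commute complex_cnj_zero)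
    then have "cinner u' w = f w / f u' * (norm u')\<^sup>2"
      by (simp add: cinner.diff_right cinner_scaleC_right cinner_self)
    then show ?thesis
      using fu' \<open>u' \<noteq> 0\<close> by (simp add: z_def cinner_scaleC_left)
  qed
  then show ?thesis
    by blast
qed

lemma cinner_eqI: "(\<And>w. cinner w x = cinner w y) \<Longrightarrow> x = y"
  for x y :: "'h::chilbert_space"
proof -
  assume "\<And>w. cinner w x = cinner w y"
  then have "cinner (x - y) (x - y) = 0"
    by (simp add: cinner.diff_right)
  then show "x = y"
    by (simp add: cinner_self)
qed

text \<open>
  The adjoint is defined by a description operator, so its defining property has content only once
  the Riesz representation provides a witness.
\<close>

lemma adj_on_UNIV:
  fixes T :: "'h::chilbert_space \<Rightarrow> 'h"
  assumes T: "bounded_op UNIV T"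
  shows "cinner w (adj_on UNIV T h) = cinner (T w) h"
proof -
  have "bounded_linear (\<lambda>w. cinner h (T w))"
    using bounded_linear_compose[OF cinner.bounded_linear_right bounded_op_UNIV(3)[OF T]] .
  then have "\<exists>z. \<forall>w. cinner h (T w) = cinner z w"
    by (rule Riesz_representation) (simp add: bounded_op_UNIV(2)[OF T] cinner_scaleC_right)
  then obtain z where z: "\<And>w. cinner h (T w) = cinner z w"
    by blast
  have z': "cinner w z = cinner (T w) h" for w
    using z[of w] cinner_commute[of w z] cinner_commute[of "T w" h] by simp
  have "adj_on UNIV T h = z"
    unfolding adjoint_op_def
  proof (rule the_equality)
    show "z \<in> UNIV \<and> (\<forall>w\<in>UNIV. cinner w z = cinner (T w) h)"
      using z' by simp
    show "z' = z" if "z' \<in> UNIV \<and> (\<forall>w\<in>UNIV. cinner w z' = cinner (T w) h)" for z'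
      by (rule cinner_eqI) (use that z' in simp)
  qed
  then show ?thesis
    using z' by simp
qed

section \<open>Closed spans\<close>

lemma bounded_linear_scaleC_left:
  "bounded_linear (\<lambda>c. c *\<^sub>C x)" for x :: "'h::complex_normed_vector"
proof (rule bounded_linear_intro)
  show "(r *\<^sub>R c) *\<^sub>C x = r *\<^sub>R (c *\<^sub>C x)" for r :: real and c
    by (simp only: scaleR_conv_of_real scaleC_scaleC[symmetric] scaleC_of_real)
  show "norm (c *\<^sub>C x) \<le> norm c * norm x" for c
    by (simp add: norm_scaleC)
qed (rule scaleC_add_left)

lemma bounded_linear_scaleC_right:
  "bounded_linear (\<lambda>x :: 'h::complex_normed_vector. c *\<^sub>C x)"
proof (rule bounded_linear_intro)
  show "c *\<^sub>C (r *\<^sub>R x) = r *\<^sub>R (c *\<^sub>C x)" for r and x :: 'h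
    by (simp only: scaleC_of_real[symmetric] scaleC_scaleC mult.commute)
  show "norm (c *\<^sub>C x) \<le> norm x * cmod c" for x :: 'h
    by (simp add: norm_scaleC)
qed (rule scaleC_add_right)

lemma closed_csubspace_closure:
  fixes X :: "'h::complex_normed_vector set"
  assumes X: "csubspace X"
  shows "closed_csubspace (closure X)"
proof -
  have "csubspace (closure X)"
  proof (rule cvs.subspaceI)
    show "0 \<in> closure X"
      using cvs.subspace_0[OF X] closure_subset by blast
    show "x + y \<in> closure X" if xy: "x \<in> closure X" "y \<in> closure X" for x y
    proof -
      obtain f g where "\<And>n. f n \<in> X" "f \<longlonglongrightarrow> x" "\<And>n. g n \<in> X" "g \<longlonglongrightarrow> y"
        using xy unfolding closure_sequential by blast
      then show ?thesis
        unfolding closure_sequential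
        by (intro exI[of _ "\<lambda>n. f n + g n"]) (simp add: tendsto_add cvs.subspace_add[OF X])
    qed
    show "c *\<^sub>C x \<in> closure X" if x: "x \<in> closure X" for c x
    proof -
      obtain f where "\<And>n. f n \<in> X" "f \<longlonglongrightarrow> x"
        using x unfolding closure_sequential by blast
      then show ?thesis
        unfolding closure_sequential
        by (intro exI[of _ "\<lambda>n. c *\<^sub>C f n"])
          (simp add: bounded_linear.tendsto[OF bounded_linear_scaleC_right] cvs.subspace_scale[OF X])
    qed
  qed
  then show ?thesis
    by (simp add: closed_csubspace_def)
qed

lemma closure_cspan_minimal:
  "A \<subseteq> W \<Longrightarrow> closed_csubspace W \<Longrightarrow> closure (cspan A) \<subseteq> W"
  unfolding closed_csubspace_def by (simp add: closure_minimal cvs.span_minimal)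

lemma closed_csubspace_annihilator:
  "closed_csubspace {y. cinner u y = 0}" for u :: "'h::chilbert_space"
  unfolding closed_csubspace_def
proof
  show "csubspace {y. cinner u y = 0}"
    by (rule cvs.subspaceI) (simp_all add: cinner.zero_right cinner.add_right cinner_scaleC_right)
  show "closed {y. cinner u y = 0}"
    by (intro closed_Collect_eq continuous_intros cinner.continuous_on)
qed

lemma cinner_eq_0_commute: "cinner x y = 0 \<longleftrightarrow> cinner y x = 0" for x y :: "'h::chilbert_space"
  using cinner_commute[of x y] by simp

section \<open>Finite dimensional subspaces and angles\<close>

lemma closed_if_compact_Int_cball:
  fixes A :: "'h::real_normed_vector set"
  assumes "\<And>r. compact (A \<inter> cball 0 r)"
  shows "closed A"
  unfolding closed_sequential_limits
proof (intro allI impI, elim conjE)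
  fix x l
  assume x: "\<forall>n. x n \<in> A" and l: "x \<longlonglongrightarrow> l"
  obtain r where r: "\<And>n. norm (x n) \<le> r"
    using convergent_imp_Bseq[OF convergentI[OF l]] by (auto simp: Bseq_def)
  have "l \<in> A \<inter> cball 0 r"
    by (rule closed_sequentially[OF compact_imp_closed[OF assms[of r]] _ l]) (use x r in simp)
  then show "l \<in> A"
    by simp
qed

text \<open>
  Induction on the spanning set.  By the induction hypothesis the span \<open>W\<close> of the smaller set is
  closed, so the new vector can be replaced by its component \<open>b'\<close> orthogonal to \<open>W\<close>.  In a
  vector \<open>k b' + u\<close> with \<open>u \<in> W\<close> both summands are then bounded by the norm of the vector, and the ball
  is a closed part of the continuous image of a product of two compact sets.
\<close>

lemma compact_cspan_cball:
  fixes B :: "'h::chilbert_space set"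
  assumes "finite B"
  shows "compact (cspan B \<inter> cball 0 r)"
  using assms
proof (induction B arbitrary: r)
  case empty
  have "cspan ({} :: 'h set) \<inter> cball 0 r = {0} \<inter> cball 0 r"
    by (simp add: cvs.span_empty)
  moreover have "compact ({0 :: 'h} \<inter> cball 0 r)"
    by (intro compact_Int_closed) auto
  ultimately show ?case
    by simp
next
  case (insert b B)
  define W where "W = cspan B"
  have W: "closed_csubspace W"
    using closed_if_compact_Int_cball[OF insert.IH]
    by (simp add: closed_csubspace_def W_def cvs.subspace_span)
  note WD = closed_csubspaceD[OF W]
  define b' where "b' = b - proj W b"
  show ?case
  proof (cases "b' = 0")
    case True
    then have "b \<in> cspan B"
      using proj_in[OF W, of b] by (simp add: b'_def W_def)
    then show ?thesis
      using insert.IH by (simp add: cvs.span_redundant)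
  next
    case False
    define F where "F = (\<lambda>(k, u). k *\<^sub>C b' + u)"
    have "compact (F ` (cball 0 (r / norm b') \<times> (W \<inter> cball 0 r)))"
      unfolding F_def case_prod_beta W_def
      by (intro compact_continuous_image compact_Times continuous_intros insert.IH compact_cball
          bounded_linear.continuous_on[OF bounded_linear_scaleC_left])
    moreover have "cspan (insert b B) \<inter> cball 0 r =
        F ` (cball 0 (r / norm b') \<times> (W \<inter> cball 0 r)) \<inter> (cball 0 r)"
    proof (intro set_eqI iffI; elim IntE; intro IntI; assumption?)
      fix v
      assume v: "v \<in> cspan (insert b B)" "v \<in> cball 0 r"
      then obtain k where k: "v - k *\<^sub>C b \<in> W"
        by (auto simp: cvs.span_insert W_def)
      define u where "u = (v - k *\<^sub>C b) + k *\<^sub>C proj W b"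
      have u: "u \<in> W"
        unfolding u_def by (intro WD k proj_in[OF W])
      have v_eq: "v = k *\<^sub>C b' + u"
        by (simp add: u_def b'_def cvs.scale_right_diff_distrib)
      have "cinner u b' = 0"
        using proj_orth[OF W, of b] u by (auto simp: b'_def orth_def)
      then have "cinner (k *\<^sub>C b') u = 0"
        by (simp add: cinner_scaleC_left cinner_eq_0_commute[of b'])
      then have "(norm v)\<^sup>2 = (norm (k *\<^sub>C b'))\<^sup>2 + (norm u)\<^sup>2"
        unfolding v_eq by (simp add: norm_add_power2)
      then have "norm (k *\<^sub>C b') \<le> norm v" "norm u \<le> norm v"
        by (simp_all add: power2_le_imp_le)
      then have "cmod k \<le> r / norm b'" "norm u \<le> r"
        using v(2) False by (simp_all add: norm_scaleC field_simps)
      then show "v \<in> F ` (cball 0 (r / norm b') \<times> (W \<inter> cball 0 r))"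
        unfolding v_eq F_def using u by (intro image_eqI[of _ _ "(k, u)"]) auto
    next
      fix v
      assume "v \<in> F ` (cball 0 (r / norm b') \<times> (W \<inter> cball 0 r))"
      then obtain k u where "u \<in> W" "v = k *\<^sub>C b' + u"
        by (auto simp: F_def)
      then have "v - k *\<^sub>C b = u - k *\<^sub>C proj W b"
        by (simp add: b'_def cvs.scale_right_diff_distrib)
      moreover have "u - k *\<^sub>C proj W b \<in> W"
        by (intro WD \<open>u \<in> W\<close> proj_in[OF W])
      ultimately have "v - k *\<^sub>C b \<in> cspan B"
        by (simp add: W_def)
      then show "v \<in> cspan (insert b B)"
        by (auto simp: cvs.span_insert)
    qed
    ultimately show ?thesis
      by (simp add: compact_Int_closed)
  qed
qed

text \<open>
  The norm of \<open>P\<^sub>M\<close> attains its maximum on the compact unit sphere of \<open>V\<close>.  The maximum is less than 1,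
  because \<open>\<parallel>P\<^sub>M v\<parallel> = \<parallel>v\<parallel>\<close> only for \<open>v \<in> M\<close>.
\<close>

lemma finite_dim_positive_angle:
  fixes V M :: "'h::chilbert_space set"
  assumes V: "closed_csubspace V" "finite_dim V" and M: "closed_csubspace M"
    and int: "M \<inter> V = {0}"
  obtains c where "0 \<le> c" "c < 1" "\<And>v. v \<in> V \<Longrightarrow> norm (proj M v) \<le> c * norm v"
proof -
  define K where "K = V \<inter> cball 0 1 \<inter> {v. norm v = 1}"
  obtain B where "finite B" "V = cspan B"
    using V(2) by (auto simp: finite_dim_def)
  then have "compact (V \<inter> cball 0 1)"
    using compact_cspan_cball by blast
  then have "compact K"
    unfolding K_def by (rule compact_Int_closed) (intro closed_Collect_eq continuous_intros)
  have K: "v \<in> K \<longleftrightarrow> v \<in> V \<and> norm v = 1" for v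
    by (auto simp: K_def)
  have "\<exists>c. 0 \<le> c \<and> c < 1 \<and> (\<forall>v\<in>K. norm (proj M v) \<le> c)"
  proof (cases "K = {}")
    case False
    obtain v where v: "v \<in> K" "\<And>u. u \<in> K \<Longrightarrow> norm (proj M u) \<le> norm (proj M v)"
      using continuous_attains_sup[OF \<open>compact K\<close> False continuous_on_norm[OF continuous_proj[OF M]]]
      by blast
    have "norm (proj M v) \<noteq> 1"
    proof
      assume "norm (proj M v) = 1"
      then have "v = proj M v"
        using norm_proj_power2[OF M, of v] v(1) by (simp add: K)
      then have "v \<in> M \<inter> V"
        using proj_in[OF M, of v] v(1) by (simp add: K)
      then show False
        using v(1) int by (auto simp: K)
    qed
    then have "norm (proj M v) < 1"
      using norm_proj_le[OF M, of v] v(1) by (simp add: K)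
    then show ?thesis
      using v(2) by (intro exI[of _ "norm (proj M v)"]) auto
  qed (auto intro: exI[of _ 0])
  then obtain c where c: "0 \<le> c" "c < 1" "\<And>v. v \<in> K \<Longrightarrow> norm (proj M v) \<le> c"
    by blast
  have "norm (proj M v) \<le> c * norm v" if v: "v \<in> V" for v
  proof (cases "v = 0")
    case True
    then show ?thesis
      using norm_proj_le[OF M, of v] by simp
  next
    case False
    have "(1 / norm v) *\<^sub>R v \<in> K"
      using False v by (simp add: K closed_csubspaceD[OF V(1)])
    then have "norm (proj M ((1 / norm v) *\<^sub>R v)) \<le> c"
      by (rule c(3))
    then show ?thesis
      using False
      by (simp only: scaleC_of_real[symmetric] proj_scaleC[OF M] norm_scaleC) (simp add: norm_divide field_simps)
  qed
  then show thesis
    using that c(1,2) by blast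
qed

section \<open>Symmetric operators on a tensor product\<close>

text \<open>
  The ratios of successive terms of a log-convex sequence increase.  If the first ratio exceeded \<open>c\<close>,
  the sequence would grow faster than \<open>C c\<^sup>n\<close>.
\<close>

lemma log_convex_first_ratio:
  fixes a :: "nat \<Rightarrow> real"
  assumes nonneg: "\<And>n. 0 \<le> a n" and convex: "\<And>n. (a (Suc n))\<^sup>2 \<le> a n * a (Suc (Suc n))"
    and bound: "\<And>n. a n \<le> C * c ^ n" and c: "0 \<le> c"
  shows "a 1 \<le> c * a 0"
proof (rule ccontr)
  assume "\<not> a 1 \<le> c * a 0"
  then have gt: "c * a 0 < a 1"
    by simp
  have a0: "0 < a 0"
  proof (rule ccontr)
    assume "\<not> 0 < a 0"
    then have "a 0 = 0"
      using nonneg[of 0] by simp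
    then show False
      using convex[of 0] gt by simp
  qed
  define r where "r = a 1 / a 0"
  have r: "c < r"
    using gt a0 by (simp add: r_def field_simps)
  then have "0 < r"
    using c by simp
  have step: "0 < a n \<and> r * a n \<le> a (Suc n)" for n
  proof (induction n)
    case 0
    then show ?case
      using a0 by (simp add: r_def)
  next
    case (Suc n)
    then have pos: "0 < a (Suc n)"
      using \<open>0 < r\<close> by (meson mult_pos_pos less_le_trans)
    have "a n * (r * a (Suc n)) = (r * a n) * a (Suc n)"
      by simp
    also have "\<dots> \<le> a (Suc n) * a (Suc n)"
      using Suc pos by (intro mult_right_mono) auto
    also have "\<dots> \<le> a n * a (Suc (Suc n))"
      using convex[of n] by (simp add: power2_eq_square)
    finally show ?case
      using pos Suc by simp
  qed
  have growth: "r ^ n * a 0 \<le> a n" for n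
  proof (induction n)
    case (Suc n)
    then have "r * (r ^ n * a 0) \<le> r * a n"
      using \<open>0 < r\<close> by simp
    then show ?case
      using step[of n] by simp
  qed simp
  show False
  proof (cases "c = 0")
    case True
    then show False
      using bound[of 1] step[of 1] by simp
  next
    case False
    then have "0 < c"
      using c by simp
    then obtain n where "C / a 0 < (r / c) ^ n"
      using real_arch_pow[of "r / c" "C / a 0"] r by auto
    then have "C * c ^ n < r ^ n * a 0"
      using \<open>0 < c\<close> a0 by (simp add: power_divide field_simps)
    then show False
      using growth[of n] bound[of n] by linarith
  qed
qed

text \<open>
  A list of pairs \<open>(w, h)\<close>, with all words \<open>w\<close> of length \<open>n\<close>, stands for the tensor
  \<open>x = \<Sum> w \<otimes> h\<close> in \<open>E\<^sup>n \<otimes> \<H>\<close>, and \<open>amplify S f\<close> is the image of \<open>(I \<otimes> f) x\<close> in \<open>\<H>\<close> under the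
  isometry \<open>w \<otimes> h \<mapsto> S\<^sub>w h\<close>.  On lists the expression makes sense for every function \<open>f\<close>, without
  any question of well-definedness.
\<close>

definition amplify :: "('e \<Rightarrow> 'h \<Rightarrow> 'h::chilbert_space) \<Rightarrow> ('h \<Rightarrow> 'h) \<Rightarrow> ('e list \<times> 'h) list \<Rightarrow> 'h" where
  "amplify S f xs = (\<Sum>(w, h)\<leftarrow>xs. foldr S w (f h))"

lemma amplify_simps [simp]:
  "amplify S f [] = 0" "amplify S f ((w, h) # xs) = foldr S w (f h) + amplify S f xs"
  by (simp_all add: amplify_def)

lemma amplify_cong:
  "(\<And>w h. (w, h) \<in> set xs \<Longrightarrow> f h = g h) \<Longrightarrow> amplify S f xs = amplify S g xs"
  unfolding amplify_def by (intro arg_cong[of _ _ sum_list] map_cong) auto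

definition elementary_tensors :: "'h set \<Rightarrow> nat \<Rightarrow> ('e list \<times> 'h) set" where
  "elementary_tensors V n = {w. length w = n} \<times> V"

text \<open>
  The space \<open>V\<^sub>n\<close>, the image of the algebraic tensor product \<open>E\<^sup>n \<otimes> V\<close> in \<open>\<H>\<close>.
\<close>

definition fiber :: "('e \<Rightarrow> 'h \<Rightarrow> 'h::chilbert_space) \<Rightarrow> 'h set \<Rightarrow> nat \<Rightarrow> 'h set" where
  "fiber S V n = cspan ((\<lambda>(w, h). foldr S w h) ` elementary_tensors V n)"

locale isometric_representation = cstar_correspondence E
  for E :: "('a::cstar_algebra, 'e::{complex_normed_vector,complete_space}) correspondence" +
  fixes S :: "'e \<Rightarrow> 'h::chilbert_space \<Rightarrow> 'h" and \<rho> :: "'a \<Rightarrow> 'h \<Rightarrow> 'h"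
  assumes isometric: "isometric E UNIV S \<rho>"
begin

lemma S_bounded: "bounded_op UNIV (S \<xi>)"
  and rho_bounded: "bounded_op UNIV (\<rho> a)"
  and rho_one: "\<rho> 1 h = h"
  using isometric by (simp_all add: isometric_def representation_def unital_star_rep_def)

lemma S_inner: "cinner (S \<xi> h) (S \<eta> k) = cinner h (\<rho> (ip E \<xi> \<eta>) k)"
  using isometric adj_on_UNIV[OF S_bounded, of h \<xi> "S \<eta> k"] by (simp add: isometric_def)

lemma rho_star: "\<rho> (star a) h = adj_on UNIV (\<rho> a) h"
  using isometric by (simp add: isometric_def representation_def unital_star_rep_def)

lemma rho_inner: "cinner (\<rho> a h) k = cinner h (\<rho> (star a) k)"
  using adj_on_UNIV[OF rho_bounded, of h a k] by (simp add: rho_star)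

lemma S_lact: "S (lact E a \<xi>) h = \<rho> a (S \<xi> h)"
proof -
  have "S (lact E a (ract E \<xi> 1)) h = \<rho> a (S \<xi> (\<rho> 1 h))"
    using isometric by (simp add: isometric_def representation_def)
  then show ?thesis
    by (simp add: ract_one rho_one)
qed

lemma bounded_linear_word: "bounded_linear (foldr S w)"
proof (induction w)
  case Nil
  then show ?case
    using bounded_linear_ident by (simp add: id_def)
next
  case (Cons \<xi> w)
  then show ?case
    using bounded_linear_compose[OF bounded_op_UNIV(3)[OF S_bounded] Cons] by (simp add: comp_def)
qed

lemma word_scaleC: "foldr S w (c *\<^sub>C h) = c *\<^sub>C foldr S w h"
  by (induction w) (simp_all add: bounded_op_UNIV(2)[OF S_bounded])

text \<open>
  The induction follows the recursion of \<open>word_ip\<close>: the outermost pair of operators contributes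
  \<open>\<rho>(\<langle>\<xi>,\<eta>\<rangle>)\<close>, and the covariance of \<open>S\<close> absorbs it as a left action on the next letter.
\<close>

lemma word_inner:
  "length v = length w \<Longrightarrow>
    cinner (foldr S v h) (foldr S w k) = cinner h (\<rho> (word_ip E v w) k)"
proof (induction v arbitrary: w)
  case Nil
  then show ?case
    by (simp add: rho_one)
next
  case (Cons \<xi> v)
  then obtain \<eta> w' where w: "w = \<eta> # w'" "length v = length w'"
    by (metis length_Suc_conv list.size(4) add_Suc_right add.right_neutral)
  show ?case
  proof (cases v)
    case Nil
    then show ?thesis
      using w by (simp add: S_inner)
  next
    case (Cons \<xi>' vs)
    then obtain \<eta>' ws where w': "w' = \<eta>' # ws"
      using w(2) by (cases w') auto
    then show ?thesis
      using Cons.IH[of "lact E (ip E \<xi> \<eta>) \<eta>' # ws"] w Cons by (simp add: S_inner S_lact)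
  qed
qed

lemma cinner_amplify:
  assumes "set xs \<subseteq> elementary_tensors UNIV n" "set ys \<subseteq> elementary_tensors UNIV n"
  shows "cinner (amplify S f xs) (amplify S g ys) =
    (\<Sum>(v, h)\<leftarrow>xs. \<Sum>(w, k)\<leftarrow>ys. cinner (f h) (\<rho> (word_ip E v w) (g k)))"
  using assms(1)
proof (induction xs)
  case Nil
  then show ?case
    by (simp add: cinner.zero_left)
next
  case (Cons x xs)
  obtain v h where x: "x = (v, h)"
    by (cases x)
  have "cinner (foldr S v (f h)) (amplify S g ys) =
      (\<Sum>(w, k)\<leftarrow>ys. cinner (f h) (\<rho> (word_ip E v w) (g k)))"
    using assms(2)
  proof (induction ys)
    case Nil
    then show ?case
      by (simp add: cinner.zero_right)
  next
    case (Cons y ys)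
    then show ?case
      using \<open>set (x # xs) \<subseteq> elementary_tensors UNIV n\<close>
      by (auto simp: x elementary_tensors_def cinner.add_right word_inner split: prod.split)
  qed
  with Cons show ?case
    by (simp add: x cinner.add_left)
qed

text \<open>
  For \<open>a = 1\<close> the condition says that \<open>T\<close> is symmetric, and then for general \<open>a\<close> that \<open>T\<close> commutes with
  \<open>\<rho>(a)\<close>.  In this combined form it says that \<open>I \<otimes> T\<close> is symmetric for the form of \<open>E\<^sup>n \<otimes> \<H>\<close>.
\<close>

definition selfadjoint_commuting :: "('h \<Rightarrow> 'h) \<Rightarrow> bool" where
  "selfadjoint_commuting T \<longleftrightarrow> (\<forall>a h k. cinner (T h) (\<rho> a k) = cinner h (\<rho> a (T k)))"

lemma amplify_symmetric:
  assumes "selfadjoint_commuting T"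
    and xs: "set xs \<subseteq> elementary_tensors UNIV n" and ys: "set ys \<subseteq> elementary_tensors UNIV n"
  shows "cinner (amplify S (T \<circ> f) xs) (amplify S g ys) =
    cinner (amplify S f xs) (amplify S (T \<circ> g) ys)"
  using assms(1) by (simp add: cinner_amplify[OF xs ys] selfadjoint_commuting_def)

lemma word_bounded: "\<exists>C\<ge>0. \<forall>h. norm (foldr S w h) \<le> C * norm h"
  using bounded_linear.nonneg_bounded[OF bounded_linear_word] by (metis mult.commute)

text \<open>
  A crude bound, whose constant depends on the number of terms of \<open>xs\<close> and on the words in it; it
  serves only to control the growth of the powers of \<open>T\<close>.
\<close>

lemma amplify_funpow_bound:
  assumes T: "\<And>h. norm (T h) \<le> c * norm h" and c: "0 \<le> c"
  shows "\<exists>C. \<forall>m. norm (amplify S (T ^^ m) xs) \<le> C * c ^ m"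
proof (induction xs)
  case Nil
  then show ?case
    by (auto intro: exI[of _ 0])
next
  case (Cons x xs)
  then obtain C where C: "\<And>m. norm (amplify S (T ^^ m) xs) \<le> C * c ^ m"
    by blast
  obtain w h where x: "x = (w, h)"
    by (cases x)
  obtain D where D: "0 \<le> D" "\<And>h. norm (foldr S w h) \<le> D * norm h"
    using word_bounded by blast
  have power: "norm ((T ^^ m) h) \<le> c ^ m * norm h" for m
  proof (induction m)
    case (Suc m)
    have "norm ((T ^^ Suc m) h) \<le> c * norm ((T ^^ m) h)"
      using T by simp
    also have "\<dots> \<le> c * (c ^ m * norm h)"
      using Suc c by (rule mult_left_mono)
    finally show ?case
      by (simp add: mult.assoc)
  qed simp
  have "norm (amplify S (T ^^ m) (x # xs)) \<le> (D * norm h + C) * c ^ m" for m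
  proof -
    have "norm (amplify S (T ^^ m) (x # xs)) \<le>
        norm (foldr S w ((T ^^ m) h)) + norm (amplify S (T ^^ m) xs)"
      by (simp add: x norm_triangle_ineq)
    also have "\<dots> \<le> D * (c ^ m * norm h) + C * c ^ m"
      using order_trans[OF D(2) mult_left_mono[OF power D(1)]] C by (rule add_mono)
    finally show ?thesis
      by (simp add: algebra_simps)
  qed
  then show ?case
    by blast
qed

text \<open>
  This is \<open>\<parallel>I \<otimes> T\<parallel> \<le> \<parallel>T\<parallel>\<close>.  Instead of a square root of \<open>c\<^sup>2 - T\<^sup>2\<close> in the commutant of \<open>\<rho>\<close>, the
  proof uses the iterates \<open>a\<^sub>m = \<parallel>(I \<otimes> T\<^sup>m) x\<parallel>\<close>: they are log-convex by symmetry and the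
  Cauchy-Schwarz inequality, and they grow at most like \<open>c\<^sup>m\<close>, so already \<open>a\<^sub>1 \<le> c a\<^sub>0\<close>.
\<close>

lemma amplify_contraction:
  assumes T: "selfadjoint_commuting T" and bound: "\<And>h. norm (T h) \<le> c * norm h" and c: "0 \<le> c"
    and xs: "set xs \<subseteq> elementary_tensors UNIV n"
  shows "norm (amplify S T xs) \<le> c * norm (amplify S id xs)"
proof -
  define a where "a m = norm (amplify S (T ^^ m) xs)" for m
  obtain C where C: "\<And>m. a m \<le> C * c ^ m"
    using amplify_funpow_bound[OF bound c] unfolding a_def by blast
  have "(a (Suc m))\<^sup>2 \<le> a m * a (Suc (Suc m))" for m
  proof -
    have "complex_of_real ((a (Suc m))\<^sup>2) =
        cinner (amplify S (T \<circ> T ^^ m) xs) (amplify S (T ^^ Suc m) xs)"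
      by (simp add: a_def cinner_self)
    also have "\<dots> = cinner (amplify S (T ^^ m) xs) (amplify S (T ^^ Suc (Suc m)) xs)"
      using amplify_symmetric[OF T xs xs] by simp
    finally have "cmod (complex_of_real ((a (Suc m))\<^sup>2)) \<le> a m * a (Suc (Suc m))"
      unfolding a_def by (simp only: cinner_Cauchy_Schwarz)
    then show ?thesis
      by (simp only: norm_of_real abs_power2)
  qed
  then have "a 1 \<le> c * a 0"
    by (intro log_convex_first_ratio[of a C c] C c) (simp_all add: a_def)
  then show ?thesis
    by (simp add: a_def)
qed

lemma fiber_obtain:
  assumes V: "csubspace V" and y: "y \<in> fiber S V n"
  obtains xs where "set xs \<subseteq> elementary_tensors V n" "y = amplify S id xs"
proof -
  have "\<exists>xs. set xs \<subseteq> elementary_tensors V n \<and> y = amplify S id xs"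
    using y unfolding fiber_def
  proof (induction rule: cvs.span_induct_alt)
    case base
    show ?case
      by (intro exI[of _ "[]"]) simp
  next
    case (step c x y)
    then obtain p xs where p: "p \<in> elementary_tensors V n" "x = (\<lambda>(w, h). foldr S w h) p"
      and "set xs \<subseteq> elementary_tensors V n" "y = amplify S id xs"
      by blast
    moreover obtain w h where "p = (w, h)"
      by (cases p)
    ultimately show ?case
      using cvs.subspace_scale[OF V]
      by (intro exI[of _ "(w, c *\<^sub>C h) # xs"]) (auto simp: word_scaleC elementary_tensors_def id_def)
  qed
  then show thesis
    using that by blast
qed

definition reducing :: "'h set \<Rightarrow> bool" where
  "reducing V \<longleftrightarrow> closed_csubspace V \<and> (\<forall>a. \<forall>v\<in>V. \<rho> a v \<in> V)"

lemma rho_proj: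
  assumes V: "reducing V"
  shows "\<rho> a (proj V k) = proj V (\<rho> a k)"
proof (rule proj_unique[symmetric])
  show closed: "closed_csubspace V"
    using V by (simp add: reducing_def)
  show "\<rho> a (proj V k) \<in> V"
    using V proj_in[OF closed] by (simp add: reducing_def)
  have "cinner v (\<rho> a (k - proj V k)) = 0" if "v \<in> V" for v
  proof -
    have "cinner v (\<rho> a (k - proj V k)) = cinner (\<rho> (star a) v) (k - proj V k)"
      by (simp add: rho_inner star_star)
    also have "\<dots> = 0"
      using V that proj_orth[OF closed, of k] by (simp add: reducing_def orth_def)
    finally show ?thesis .
  qed
  then show "\<rho> a k - \<rho> a (proj V k) \<in> orth V"
    by (simp add: orth_def linear_diff[OF bounded_linear.linear[OF bounded_op_UNIV(3)[OF rho_bounded]]])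
qed

lemma selfadjoint_commuting_proj:
  assumes V: "reducing V"
  shows "selfadjoint_commuting (proj V)"
  using V proj_symmetric[of V] by (simp add: selfadjoint_commuting_def rho_proj reducing_def)

lemma selfadjoint_commuting_sandwich:
  "selfadjoint_commuting P \<Longrightarrow> selfadjoint_commuting Q \<Longrightarrow> selfadjoint_commuting (P \<circ> Q \<circ> P)"
  by (simp add: selfadjoint_commuting_def)

text \<open>
  On tensors with entries in \<open>V\<close> the operator \<open>I \<otimes> P\<^sub>M\<close> agrees with \<open>I \<otimes> P\<^sub>M P\<^sub>V\<close>, and the square of
  the norm of the latter is governed by \<open>K = P\<^sub>V P\<^sub>M P\<^sub>V\<close>, which is symmetric, commutes with \<open>\<rho>\<close>
  and has norm at most \<open>c\<close>.
\<close>

lemma amplify_angle: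
  assumes V: "reducing V" and M: "reducing M" and c: "0 \<le> c"
    and angle: "\<And>v. v \<in> V \<Longrightarrow> norm (proj M v) \<le> c * norm v"
    and xs: "set xs \<subseteq> elementary_tensors V n"
  shows "norm (amplify S (proj M) xs) \<le> sqrt c * norm (amplify S id xs)"
proof -
  have clV: "closed_csubspace V" and clM: "closed_csubspace M"
    using V M by (simp_all add: reducing_def)
  note PV = selfadjoint_commuting_proj[OF V] and PM = selfadjoint_commuting_proj[OF M]
  have ws: "set xs \<subseteq> elementary_tensors UNIV n"
    using xs by (auto simp: elementary_tensors_def)
  have fixed: "proj V h = h" if "(w, h) \<in> set xs" for w h
    using that xs proj_ident[OF clV] by (auto simp: elementary_tensors_def)
  define K where "K = proj V \<circ> proj M \<circ> proj V"
  have "norm (K h) \<le> c * norm h" for h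
  proof -
    have "norm (K h) \<le> norm (proj M (proj V h))"
      by (simp add: K_def norm_proj_le[OF clV])
    also have "\<dots> \<le> c * norm (proj V h)"
      by (intro angle proj_in clV)
    also have "\<dots> \<le> c * norm h"
      using norm_proj_le[OF clV] c by (rule mult_left_mono)
    finally show ?thesis .
  qed
  then have K: "norm (amplify S K xs) \<le> c * norm (amplify S id xs)"
    using amplify_contraction[OF selfadjoint_commuting_sandwich[OF PV PM] _ c ws] by (simp add: K_def)
  have "complex_of_real ((norm (amplify S (proj M) xs))\<^sup>2) =
      cinner (amplify S (proj M \<circ> id) xs) (amplify S (proj M) xs)"
    by (simp add: cinner_self)
  also have "\<dots> = cinner (amplify S id xs) (amplify S (proj M \<circ> proj M) xs)"
    by (rule amplify_symmetric[OF PM ws ws])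
  also have "amplify S (proj M \<circ> proj M) xs = amplify S (proj M \<circ> proj V) xs"
    using fixed by (intro amplify_cong) (simp add: proj_ident[OF clM proj_in[OF clM]])
  also have "amplify S id xs = amplify S (proj V \<circ> id) xs"
    using fixed by (intro amplify_cong) simp
  also have "cinner (amplify S (proj V \<circ> id) xs) (amplify S (proj M \<circ> proj V) xs) =
      cinner (amplify S id xs) (amplify S K xs)"
    by (simp only: amplify_symmetric[OF PV ws ws] K_def comp_assoc)
  finally have "cmod (complex_of_real ((norm (amplify S (proj M) xs))\<^sup>2)) \<le>
      norm (amplify S id xs) * norm (amplify S K xs)"
    using cinner_Cauchy_Schwarz by metis
  then have "(norm (amplify S (proj M) xs))\<^sup>2 \<le> norm (amplify S id xs) * norm (amplify S K xs)"
    by (simp only: norm_of_real abs_power2)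
  also have "\<dots> \<le> norm (amplify S id xs) * (c * norm (amplify S id xs))"
    using K by (intro mult_left_mono) auto
  also have "\<dots> = (sqrt c * norm (amplify S id xs))\<^sup>2"
    using c by (simp add: power_mult_distrib power2_eq_square)
  finally show ?thesis
    by (rule power2_le_imp_le) (simp add: c)
qed

section \<open>Coinvariant subspaces\<close>

text \<open>
  Invariance of \<open>V\<close> under the adjoints of the \<open>\<rho>(a)\<close> and the \<open>S(\<xi>)\<close>, expressed without adjoints.
\<close>

definition coinvariant :: "'h set \<Rightarrow> bool" where
  "coinvariant V \<longleftrightarrow> reducing V \<and> (\<forall>\<xi>. \<forall>h\<in>orth V. S \<xi> h \<in> orth V)"

lemma coinvariant_word:
  assumes "coinvariant V" "h \<in> orth V"
  shows "foldr S w h \<in> orth V"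
  using assms by (induction w) (auto simp: coinvariant_def)

text \<open>
  Since \<open>S\<^sub>w\<close> maps the complement of \<open>M\<close> into itself, \<open>m \<in> M\<close> only sees the components
  \<open>P\<^sub>M h\<close> of the entries \<open>h\<close> of a tensor.
\<close>

lemma fiber_angle:
  assumes V: "reducing V" and M: "coinvariant M" and c: "0 \<le> c"
    and angle: "\<And>v. v \<in> V \<Longrightarrow> norm (proj M v) \<le> c * norm v"
    and m: "m \<in> M" and y: "y \<in> fiber S V n"
  shows "cmod (cinner m y) \<le> sqrt c * norm m * norm y"
proof -
  have clM: "closed_csubspace M" and redM: "reducing M" and "csubspace V"
    using V M by (simp_all add: coinvariant_def reducing_def closed_csubspace_def)
  obtain xs where xs: "set xs \<subseteq> elementary_tensors V n" "y = amplify S id xs"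
    using fiber_obtain[OF \<open>csubspace V\<close> y] by blast
  have "cinner m (amplify S id zs) = cinner m (amplify S (proj M) zs)" for zs
  proof (induction zs)
    case (Cons z zs)
    obtain w h where z: "z = (w, h)"
      by (cases z)
    have "foldr S w (h - proj M h) \<in> orth M"
      by (rule coinvariant_word[OF M proj_orth[OF clM]])
    then have "cinner m (foldr S w h) = cinner m (foldr S w (proj M h))"
      using m by (simp add: orth_def linear_diff[OF bounded_linear.linear[OF bounded_linear_word]] cinner.diff_right)
    then show ?case
      using Cons by (simp add: z cinner.add_right)
  qed simp
  then have "cmod (cinner m y) \<le> norm m * norm (amplify S (proj M) xs)"
    using cinner_Cauchy_Schwarz by (simp add: xs(2))
  also have "\<dots> \<le> norm m * (sqrt c * norm y)"
    unfolding xs(2) by (intro mult_left_mono amplify_angle[OF V redM c angle xs(1)]) auto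
  finally show ?thesis
    by (simp add: mult_ac)
qed

lemma word_in_fiber: "length w = n \<Longrightarrow> h \<in> V \<Longrightarrow> foldr S w h \<in> fiber S V n"
  unfolding fiber_def elementary_tensors_def by (intro cvs.span_base image_eqI[of _ _ "(w, h)"]) auto

lemma closed_csubspace_closure_fiber: "closed_csubspace (closure (fiber S V n))"
  unfolding fiber_def by (intro closed_csubspace_closure cvs.subspace_span)

text \<open>
  Let \<open>u\<close> be the component of \<open>v \<in> V\<close> orthogonal to the closure \<open>N\<close> of \<open>V\<^sub>1\<close>.  It is orthogonal to
  \<open>S(\<xi>)k\<close> for \<open>k \<in> V\<close>, as this lies in \<open>N\<close>, and to \<open>S(\<xi>)h'\<close> for \<open>h' \<bottom> V\<close>: such a vector is orthogonal
  to \<open>v\<close> by coinvariance, and to \<open>N\<close> because \<open>\<langle>S(\<xi>)h', S(\<eta>)k\<rangle> = \<langle>h', \<rho>(\<langle>\<xi>,\<eta>\<rangle>)k\<rangle> = 0\<close>.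
  So \<open>u\<close> is orthogonal to the whole range of \<open>S\<close>, which by \<open>total\<close> leaves only \<open>u = 0\<close>.
\<close>

lemma coinvariant_subset_fiber:
  assumes V: "coinvariant V" and total: "\<And>u. (\<And>\<xi> h. cinner u (S \<xi> h) = 0) \<Longrightarrow> u = 0"
  shows "V \<subseteq> closure (fiber S V 1)"
proof
  fix v
  assume v: "v \<in> V"
  define N where "N = closure (fiber S V 1)"
  have N: "closed_csubspace N"
    unfolding N_def by (rule closed_csubspace_closure_fiber)
  have clV: "closed_csubspace V"
    using V by (simp add: coinvariant_def reducing_def)
  define u where "u = v - proj N v"
  have "cinner u (S \<xi> h) = 0" for \<xi> h
  proof -
    define h' where "h' = h - proj V h"
    have h': "h' \<in> orth V"
      unfolding h'_def by (rule proj_orth[OF clV])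
    have "S \<xi> (proj V h) \<in> N"
      using word_in_fiber[of "[\<xi>]" 1 "proj V h" V] proj_in[OF clV] closure_subset
      by (auto simp: N_def)
    then have "cinner u (S \<xi> (proj V h)) = 0"
      using proj_orth[OF N, of v] by (simp add: u_def[symmetric] orth_def cinner_eq_0_commute[of u])
    moreover have "cinner v (S \<xi> h') = 0"
      using V v h' by (simp add: coinvariant_def orth_def)
    moreover have "cinner (proj N v) (S \<xi> h') = 0"
    proof -
      have "cinner (S \<xi> h') (foldr S w k) = 0"
        if wk: "(w, k) \<in> elementary_tensors V 1" for w :: "'e list" and k
      proof -
        obtain \<eta> where w: "w = [\<eta>]" and k: "k \<in> V"
          using wk by (auto simp: elementary_tensors_def length_Suc_conv)
        have "cinner h' (\<rho> (ip E \<xi> \<eta>) k) = 0"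
          using V k h' by (simp add: coinvariant_def reducing_def orth_def cinner_eq_0_commute[of h'])
        then show ?thesis
          by (simp add: w S_inner)
      qed
      then have "(\<lambda>(w, k). foldr S w k) ` elementary_tensors V 1 \<subseteq> {y. cinner (S \<xi> h') y = 0}"
        by auto
      then have "N \<subseteq> {y. cinner (S \<xi> h') y = 0}"
        unfolding N_def fiber_def by (rule closure_cspan_minimal[OF _ closed_csubspace_annihilator])
      then show ?thesis
        using proj_in[OF N, of v] by (auto simp: cinner_eq_0_commute[of "proj N v"])
    qed
    moreover have "S \<xi> h = S \<xi> (proj V h) + S \<xi> h'"
      unfolding bounded_op_UNIV(1)[OF S_bounded, symmetric] h'_def by simp
    ultimately show ?thesis
      by (simp add: cinner.add_right u_def cinner.diff_left)
  qed
  then have "u = 0"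
    by (rule total)
  then have "v = proj N v"
    by (simp add: u_def)
  then show "v \<in> closure (fiber S V 1)"
    using proj_in[OF N, of v] by (simp add: N_def)
qed

text \<open>
  Apply \<open>S\<^sub>w\<close>, for a word \<open>w\<close> of length \<open>n\<close>, to the inclusion of \<open>V\<close> in the closure of \<open>V\<^sub>1\<close>.
\<close>

lemma closure_fiber_mono:
  assumes V: "coinvariant V" and total: "\<And>u. (\<And>\<xi> h. cinner u (S \<xi> h) = 0) \<Longrightarrow> u = 0"
    and mn: "m \<le> n"
  shows "closure (fiber S V m) \<subseteq> closure (fiber S V n)"
proof -
  have step: "closure (fiber S V n) \<subseteq> closure (fiber S V (Suc n))" for n
  proof -
    have "foldr S w h \<in> closure (fiber S V (Suc n))" if w: "length w = n" and h: "h \<in> V" for w h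
    proof -
      have "foldr S w ` fiber S V 1 \<subseteq> fiber S V (Suc n)"
      proof
        fix z
        assume "z \<in> foldr S w ` fiber S V 1"
        then obtain y where y: "y \<in> fiber S V 1" "z = foldr S w y"
          by blast
        have "foldr S w y \<in> fiber S V (Suc n)"
          using y(1) unfolding fiber_def[of S V 1]
        proof (induction rule: cvs.span_induct_alt)
          case base
          show ?case
            by (simp add: linear_0[OF bounded_linear.linear[OF bounded_linear_word]]
                fiber_def cvs.span_zero)
        next
          case (step c x y)
          then obtain v h where x: "x = foldr S v h" "length v = 1" "h \<in> V"
            by (auto simp: elementary_tensors_def)
          have "foldr S w x \<in> fiber S V (Suc n)"
            using word_in_fiber[of "w @ v" "Suc n" h V] x w by simp
          with step show ?case
            by (simp add: linear_add[OF bounded_linear.linear[OF bounded_linear_word]] word_scaleC fiber_def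
                cvs.span_add cvs.span_scale)
        qed
        then show "z \<in> fiber S V (Suc n)"
          by (simp add: y(2))
      qed
      then have "foldr S w ` closure (fiber S V 1) \<subseteq> closure (fiber S V (Suc n))"
        using closure_subset
        by (intro image_closure_subset[OF bounded_linear.continuous_on[OF bounded_linear_word]])
          (auto intro: continuous_on_id)
      then show ?thesis
        using coinvariant_subset_fiber[OF V total] h by auto
    qed
    then show ?thesis
      unfolding fiber_def[of S V n]
      by (intro closure_cspan_minimal closed_csubspace_closure_fiber) (auto simp: elementary_tensors_def)
  qed
  show ?thesis
    using mn by (rule lift_Suc_mono_le[of "\<lambda>n. closure (fiber S V n)", OF step])
qed

lemma coinvariant_intersection:
  assumes V: "coinvariant V" "finite_dim V" and M: "coinvariant M" "M \<noteq> {0}"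
    and total: "\<And>u. (\<And>\<xi> h. cinner u (S \<xi> h) = 0) \<Longrightarrow> u = 0"
    and minimal: "closure (cspan (\<Union>n. closure (fiber S V n))) = UNIV"
  shows "M \<inter> V \<noteq> {0}"
proof
  assume int: "M \<inter> V = {0}"
  have red: "reducing V" and clV: "closed_csubspace V" and clM: "closed_csubspace M"
    using V M by (simp_all add: coinvariant_def reducing_def)
  obtain c where c: "0 \<le> c" "c < 1" "\<And>v. v \<in> V \<Longrightarrow> norm (proj M v) \<le> c * norm v"
    using finite_dim_positive_angle[OF clV V(2) clM int] by blast
  obtain m where m: "m \<in> M" "m \<noteq> 0"
    using M(2) closed_csubspaceD(1)[OF clM] by blast
  define F where "F = (\<lambda>n. closure (fiber S V n))"
  define C where "C = {y. cmod (cinner m y) \<le> sqrt c * norm m * norm y}"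
  have "closed C"
    unfolding C_def
    by (intro closed_Collect_le continuous_intros cinner.continuous_on)
  have "F n \<subseteq> C" for n
    unfolding F_def using fiber_angle[OF red M(1) c(1,3) m(1)] \<open>closed C\<close>
    by (intro closure_minimal) (auto simp: C_def)
  \<comment> \<open>The union of the increasing chain is a subspace, so minimality makes it dense in the whole space.\<close>
  have "csubspace (\<Union>n. F n)"
  proof (rule cvs.subspaceI)
    have F: "closed_csubspace (F n)" for n
      unfolding F_def by (rule closed_csubspace_closure_fiber)
    note FD = closed_csubspaceD[OF F]
    show "0 \<in> (\<Union>n. F n)"
      using FD(1) by blast
    show "c *\<^sub>C x \<in> (\<Union>n. F n)" if "x \<in> (\<Union>n. F n)" for c x
      using that FD(3) by blast
    show "x + y \<in> (\<Union>n. F n)" if xy: "x \<in> (\<Union>n. F n)" "y \<in> (\<Union>n. F n)" for x y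
    proof -
      obtain i j where "x \<in> F i" "y \<in> F j"
        using xy by blast
      then have "x \<in> F (max i j)" "y \<in> F (max i j)"
        using closure_fiber_mono[OF V(1) total] unfolding F_def by (meson max.cobounded1 max.cobounded2 subsetD)+
      then show ?thesis
        using FD(2) by blast
    qed
  qed
  then have "cspan (\<Union>n. F n) = (\<Union>n. F n)"
    by (simp only: cvs.span_eq_iff)
  then have "closure (\<Union>n. F n) = UNIV"
    using minimal unfolding F_def by metis
  moreover have "closure (\<Union>n. F n) \<subseteq> C"
    using \<open>\<And>n. F n \<subseteq> C\<close> \<open>closed C\<close> by (intro closure_minimal) auto
  ultimately have "m \<in> C"
    by blast
  then have "cmod (complex_of_real ((norm m)\<^sup>2)) \<le> sqrt c * norm m * norm m"
    by (simp only: C_def mem_Collect_eq cinner_self)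
  then have "norm m * norm m \<le> sqrt c * (norm m * norm m)"
    by (simp only: norm_of_real) (simp add: power2_eq_square)
  then have "1 \<le> sqrt c"
    using m(2) by simp
  then show False
    using c by simp
qed

section \<open>The completed tensor products\<close>

lemma pretensors_mono: "V \<subseteq> W \<Longrightarrow> x \<in> pretensors V n \<Longrightarrow> x \<in> pretensors W n"
  by (auto simp: pretensors_def)

lemma pretensors_diff: "x \<in> pretensors V n \<Longrightarrow> y \<in> pretensors V n \<Longrightarrow> x - y \<in> pretensors V n"
  for x y :: "('e, 'h) pretensor"
  using keys_diff[of x y] by (auto simp: pretensors_def)

lemma pre_tilde_superset:
  assumes "finite A" "Poly_Mapping.keys x \<subseteq> A"
  shows "pre_tilde S x = (\<Sum>(w, h)\<in>A. Poly_Mapping.lookup x (w, h) *\<^sub>C foldr S w h)"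
  unfolding pre_tilde_def using assms
  by (intro sum.mono_neutral_left) (auto simp: in_keys_iff)

lemma pre_tilde_diff: "pre_tilde S (x - y) = pre_tilde S x - pre_tilde S y"
proof -
  let ?A = "Poly_Mapping.keys x \<union> Poly_Mapping.keys y"
  have "finite ?A"
    by simp
  note superset = pre_tilde_superset[OF this]
  have "pre_tilde S (x - y) = (\<Sum>(w, h)\<in>?A. Poly_Mapping.lookup (x - y) (w, h) *\<^sub>C foldr S w h)"
    using keys_diff[of x y] by (rule superset)
  also have "\<dots> = (\<Sum>(w, h)\<in>?A. Poly_Mapping.lookup x (w, h) *\<^sub>C foldr S w h) -
      (\<Sum>(w, h)\<in>?A. Poly_Mapping.lookup y (w, h) *\<^sub>C foldr S w h)"
    unfolding sum_subtractf[symmetric]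
    by (intro sum.cong) (auto simp: lookup_minus cvs.scale_left_diff_distrib)
  also have "\<dots> = pre_tilde S x - pre_tilde S y"
    by (simp add: superset)
  finally show ?thesis .
qed

lemma pre_tilde_fiber:
  assumes "x \<in> pretensors V n"
  shows "pre_tilde S x \<in> fiber S V n"
  unfolding pre_tilde_def fiber_def
proof (intro cvs.span_sum, clarify, intro cvs.span_scale, fold fiber_def)
  fix w h
  assume "(w, h) \<in> Poly_Mapping.keys x"
  then show "foldr S w h \<in> fiber S V n"
    using assms by (intro word_in_fiber) (auto simp: pretensors_def)
qed

lemma tensor_form_eq:
  assumes "x \<in> pretensors UNIV n" "y \<in> pretensors UNIV n"
  shows "tensor_form E \<rho> x y = cinner (pre_tilde S x) (pre_tilde S y)"
proof -
  have "cinner (pre_tilde S x) (pre_tilde S y) =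
      (\<Sum>p\<in>Poly_Mapping.keys x. \<Sum>q\<in>Poly_Mapping.keys y.
        cnj (Poly_Mapping.lookup x p) * (Poly_Mapping.lookup y q *
        cinner (foldr S (fst p) (snd p)) (foldr S (fst q) (snd q))))"
    by (simp add: pre_tilde_def case_prod_beta cinner.sum_left cinner.sum_right
        cinner_scaleC_left cinner_scaleC_right sum_distrib_left mult.left_commute)
      (rule sum.swap)
  also have "\<dots> = tensor_form E \<rho> x y"
    unfolding tensor_form_def case_prod_beta
  proof (intro sum.cong refl)
    fix p q
    assume "p \<in> Poly_Mapping.keys x" "q \<in> Poly_Mapping.keys y"
    then have "length (fst p) = n" "length (fst q) = n"
      using assms by (force simp: pretensors_def)+
    then show "cnj (Poly_Mapping.lookup x p) * (Poly_Mapping.lookup y q *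
        cinner (foldr S (fst p) (snd p)) (foldr S (fst q) (snd q))) =
      cnj (Poly_Mapping.lookup x (fst p, snd p)) * Poly_Mapping.lookup y (fst q, snd q) *
        cinner (snd p) (\<rho> (word_ip E (fst p) (fst q)) (snd q))"
      by (simp add: word_inner)
  qed
  finally show ?thesis ..
qed

lemma semi_norm_diff:
  assumes "x \<in> pretensors V n" "y \<in> pretensors V n"
  shows "semi_norm (tensor_form E \<rho>) (x - y) = norm (pre_tilde S x - pre_tilde S y)"
proof -
  have "x - y \<in> pretensors UNIV n"
    using pretensors_mono[OF subset_UNIV pretensors_diff[OF assms]] .
  then show ?thesis
    by (simp add: semi_norm_def tensor_form_eq cinner_self pre_tilde_diff)
qed

abbreviation cauchy :: "'h set \<Rightarrow> nat \<Rightarrow> (nat \<Rightarrow> ('e, 'h) pretensor) set" where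
  "cauchy V n \<equiv> cauchy_seqs (pretensors V n) (tensor_form E \<rho>)"

lemma cauchy_seqs_iff:
  "x \<in> cauchy V n \<longleftrightarrow> (\<forall>m. x m \<in> pretensors V n) \<and> Cauchy (\<lambda>m. pre_tilde S (x m))"
  unfolding cauchy_seqs_def Cauchy_def
  by (auto simp: semi_norm_diff[where V = V and n = n] dist_norm cong: conj_cong)

text \<open>
  A class of Cauchy sequences is determined by the common limit in \<open>\<H>\<close> of the images of its
  members, because the seminorm of the completion is the norm of these images.
\<close>

lemma tensor_space_class:
  assumes "z \<in> tensor_space E V \<rho> n"
  shows "\<exists>x v. x \<in> cauchy V n \<and> (\<lambda>m. pre_tilde S (x m)) \<longlonglongrightarrow> v \<and>
    z = {y \<in> cauchy V n. (\<lambda>m. pre_tilde S (y m)) \<longlonglongrightarrow> v}"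
proof -
  obtain x where x: "x \<in> cauchy V n" and
    z: "z = null_rel (pretensors V n) (tensor_form E \<rho>) `` {x}"
    using assms unfolding tensor_space_def completion_def by (elim quotientE)
  obtain v where v: "(\<lambda>m. pre_tilde S (x m)) \<longlonglongrightarrow> v"
    using x Cauchy_convergent by (auto simp: cauchy_seqs_iff convergent_def)
  have "(x, y) \<in> null_rel (pretensors V n) (tensor_form E \<rho>) \<longleftrightarrow>
      (\<lambda>m. pre_tilde S (y m)) \<longlonglongrightarrow> v" if y: "y \<in> cauchy V n" for y
  proof -
    have "(x, y) \<in> null_rel (pretensors V n) (tensor_form E \<rho>) \<longleftrightarrow>
        (\<lambda>m. pre_tilde S (x m) - pre_tilde S (y m)) \<longlonglongrightarrow> 0"
      using x y
      by (simp add: null_rel_def cauchy_seqs_iff semi_norm_diff[where V = V and n = n]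
          tendsto_norm_zero_iff)
    also have "\<dots> \<longleftrightarrow> (\<lambda>m. pre_tilde S (y m)) \<longlonglongrightarrow> v"
    proof
      assume "(\<lambda>m. pre_tilde S (x m) - pre_tilde S (y m)) \<longlonglongrightarrow> 0"
      from tendsto_diff[OF v this] show "(\<lambda>m. pre_tilde S (y m)) \<longlonglongrightarrow> v"
        by simp
    next
      assume "(\<lambda>m. pre_tilde S (y m)) \<longlonglongrightarrow> v"
      from tendsto_diff[OF v this] show "(\<lambda>m. pre_tilde S (x m) - pre_tilde S (y m)) \<longlonglongrightarrow> 0"
        by simp
    qed
    finally show ?thesis .
  qed
  moreover have "y \<in> cauchy V n" if "(x, y) \<in> null_rel (pretensors V n) (tensor_form E \<rho>)" for y
    using that by (simp add: null_rel_def)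
  ultimately have "z = {y \<in> cauchy V n. (\<lambda>m. pre_tilde S (y m)) \<longlonglongrightarrow> v}"
    unfolding z by blast
  then show ?thesis
    using x v by blast
qed

lemma tilde_eqI:
  assumes "x \<in> z" and "\<And>y. y \<in> z \<Longrightarrow> (\<lambda>m. pre_tilde S (y m)) \<longlonglongrightarrow> v"
  shows "tilde S z = v"
  unfolding tilde_def extension_def
proof (rule the_equality)
  show "\<forall>y\<in>z. (\<lambda>m. pre_tilde S (y m)) \<longlonglongrightarrow> v"
    using assms(2) by blast
  show "u = v" if "\<forall>y\<in>z. (\<lambda>m. pre_tilde S (y m)) \<longlonglongrightarrow> u" for u
    using LIMSEQ_unique that assms by blast
qed

lemma tensor_space_eq:
  assumes "z \<in> tensor_space E V \<rho> n"
  shows "z = {y \<in> cauchy V n. (\<lambda>m. pre_tilde S (y m)) \<longlonglongrightarrow> tilde S z}"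
    and "\<exists>x. x \<in> z"
proof -
  obtain x v where x: "x \<in> cauchy V n" "(\<lambda>m. pre_tilde S (x m)) \<longlonglongrightarrow> v" and
    z: "z = {y \<in> cauchy V n. (\<lambda>m. pre_tilde S (y m)) \<longlonglongrightarrow> v}"
    using tensor_space_class[OF assms] by blast
  then have "x \<in> z" and "tilde S z = v"
    by (simp, intro tilde_eqI[of x]) auto
  then show "z = {y \<in> cauchy V n. (\<lambda>m. pre_tilde S (y m)) \<longlonglongrightarrow> tilde S z}" "\<exists>x. x \<in> z"
    using z by auto
qed

lemma tensor_spaceD:
  assumes "z \<in> tensor_space E V \<rho> n" "x \<in> z"
  shows "x m \<in> pretensors V n" "(\<lambda>m. pre_tilde S (x m)) \<longlonglongrightarrow> tilde S z"
  using assms(2) by (subst (asm) tensor_space_eq(1)[OF assms(1)], simp add: cauchy_seqs_iff)+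

lemma tilde_in_closure_fiber:
  assumes z: "z \<in> tensor_space E V \<rho> n"
  shows "tilde S z \<in> closure (fiber S V n)"
proof -
  obtain x where "x \<in> z"
    using tensor_space_eq(2)[OF z] by blast
  then show ?thesis
    unfolding closure_sequential using tensor_spaceD[OF z] pre_tilde_fiber
    by (intro exI[of _ "\<lambda>m. pre_tilde S (x m)"]) blast
qed

lemma tensor_ip_eq:
  assumes z: "z \<in> tensor_space E V \<rho> n" and w: "w \<in> tensor_space E V \<rho> n"
  shows "tensor_ip E \<rho> z w = cinner (tilde S z) (tilde S w)"
proof -
  obtain x y where xy: "x \<in> z" "y \<in> w"
    using tensor_space_eq(2) z w by metis
  have lim: "(\<lambda>m. tensor_form E \<rho> (x m) (y m)) \<longlonglongrightarrow> cinner (tilde S z) (tilde S w)"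
    if "x \<in> z" "y \<in> w" for x y
  proof -
    note x = tensor_spaceD[OF z that(1)] and y = tensor_spaceD[OF w that(2)]
    have "tensor_form E \<rho> (x m) (y m) = cinner (pre_tilde S (x m)) (pre_tilde S (y m))" for m
      by (intro tensor_form_eq[of _ n] pretensors_mono[OF subset_UNIV x(1)]
          pretensors_mono[OF subset_UNIV y(1)])
    then show ?thesis
      using cinner.tendsto[OF x(2) y(2)] by simp
  qed
  show ?thesis
    unfolding completion_ip_def
  proof (rule the_equality)
    show "\<forall>x\<in>z. \<forall>y\<in>w. (\<lambda>m. tensor_form E \<rho> (x m) (y m)) \<longlonglongrightarrow> cinner (tilde S z) (tilde S w)"
      using lim by blast
    show "c = cinner (tilde S z) (tilde S w)"
      if "\<forall>x\<in>z. \<forall>y\<in>w. (\<lambda>m. tensor_form E \<rho> (x m) (y m)) \<longlonglongrightarrow> c" for c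
      using LIMSEQ_unique[OF _ lim[OF xy]] that xy by blast
  qed
qed

lemma tilde_injective:
  assumes "z \<in> tensor_space E V \<rho> n" "w \<in> tensor_space E V \<rho> n" "tilde S z = tilde S w"
  shows "z = w"
  using tensor_space_eq(1)[OF assms(1)] tensor_space_eq(1)[OF assms(2)] assms(3) by simp

lemma tensor_space_zero: "\<exists>z\<in>tensor_space E V \<rho> n. tilde S z = 0"
proof -
  have zero: "pre_tilde S (0 :: ('e, 'h) pretensor) = 0"
    by (simp add: pre_tilde_def)
  have "(0 :: ('e, 'h) pretensor) \<in> pretensors V n"
    by (simp add: pretensors_def)
  then have cauchy: "(\<lambda>_. 0) \<in> cauchy V n"
    by (simp add: cauchy_seqs_iff zero Cauchy_def)
  then have z: "null_rel (pretensors V n) (tensor_form E \<rho>) `` {\<lambda>_. 0} \<in> tensor_space E V \<rho> n"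
    unfolding tensor_space_def completion_def by (rule quotientI)
  have mem: "(\<lambda>_. 0) \<in> null_rel (pretensors V n) (tensor_form E \<rho>) `` {\<lambda>_. 0}"
    using cauchy by (simp add: null_rel_def semi_norm_def tensor_form_def)
  have "tilde S (null_rel (pretensors V n) (tensor_form E \<rho>) `` {\<lambda>_. 0}) = 0"
    using tensor_spaceD(2)[OF z mem] by (simp add: zero LIMSEQ_const_iff)
  with z show ?thesis
    by blast
qed

text \<open>
  If \<open>u\<close> is orthogonal to the range of \<open>S\<close>, the zero class solves the equation that defines the
  adjoint of \<open>tilde S\<close> at \<open>u\<close>, and it is the only one: a solution is orthogonal to itself, and \<open>tilde S\<close> is isometric.  So
  \<open>tilde S\<close> maps the value of the adjoint at \<open>u\<close> to 0, while full coisometry says that it maps it to \<open>u\<close>.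
\<close>

lemma fully_coisometric_total:
  assumes coisometric: "fully_coisometric E UNIV S \<rho>" and orth: "\<And>\<xi> h. cinner u (S \<xi> h) = 0"
  shows "u = 0"
proof -
  let ?K = "tensor_space E UNIV \<rho> 1"
  have "closure (fiber S UNIV 1) \<subseteq> {y. cinner u y = 0}"
    unfolding fiber_def
    by (rule closure_cspan_minimal[OF _ closed_csubspace_annihilator])
      (auto simp: elementary_tensors_def length_Suc_conv orth)
  then have ker: "cinner (tilde S w) u = 0" if "w \<in> ?K" for w
    using tilde_in_closure_fiber[OF that] by (auto simp: cinner_eq_0_commute[of _ u])
  obtain z where z: "z \<in> ?K" "tilde S z = 0"
    using tensor_space_zero by blast
  have "adjoint_op ?K (tensor_ip E \<rho>) (tilde S) u = z"
    unfolding adjoint_op_def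
  proof (rule the_equality)
    show "z \<in> ?K \<and> (\<forall>w\<in>?K. tensor_ip E \<rho> w z = cinner (tilde S w) u)"
      using z by (simp add: tensor_ip_eq ker cinner.zero_right)
    show "y = z" if y: "y \<in> ?K \<and> (\<forall>w\<in>?K. tensor_ip E \<rho> w y = cinner (tilde S w) u)" for y
    proof -
      have "cinner (tilde S y) (tilde S y) = 0"
        using y ker by (metis tensor_ip_eq)
      then have "tilde S y = tilde S z"
        by (simp add: cinner_self z(2))
      then show ?thesis
        using tilde_injective y z(1) by blast
    qed
  qed
  then show ?thesis
    using coisometric z(2) by (auto simp: fully_coisometric_def)
qed

section \<open>The weakly closed algebra and the intersection theorem\<close>

lemma generated_in_wot_algebra:
  assumes "T \<in> generated_algebra S \<rho>" "bounded_op UNIV T"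
  shows "T \<in> wot_algebra S \<rho>"
proof -
  have "T \<in> topspace wot"
    using assms(2) by (simp add: wot_def topspace_pullback_topology)
  then show ?thesis
    using assms(1) closure_of_subset_Int[of wot "generated_algebra S \<rho>"]
    by (auto simp: wot_algebra_def)
qed

lemma coinvariant_if_adjoints_invariant:
  assumes V: "closed_csubspace V" and inv: "invariant_under (adjoints (wot_algebra S \<rho>)) V"
  shows "coinvariant V"
proof -
  have adj: "adj_on UNIV T v \<in> V" if "T \<in> generated_algebra S \<rho>" "bounded_op UNIV T" "v \<in> V" for T v
    using inv generated_in_wot_algebra[OF that(1,2)] that(3)
    by (auto simp: invariant_under_def adjoints_def)
  have "\<rho> a v \<in> V" if "v \<in> V" for a v
    using adj[OF gen_rho rho_bounded that, of "star a"] by (simp add: rho_star[symmetric] star_star)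
  moreover have "S \<xi> h \<in> orth V" if h: "h \<in> orth V" for \<xi> h
    unfolding orth_def
  proof clarify
    fix v
    assume "v \<in> V"
    then have "cinner (adj_on UNIV (S \<xi>) v) h = 0"
      using adj[OF gen_S S_bounded] h by (simp add: orth_def)
    then show "cinner v (S \<xi> h) = 0"
      using adj_on_UNIV[OF S_bounded, of h \<xi> v] by (simp add: cinner_eq_0_commute)
  qed
  ultimately show ?thesis
    using V by (simp add: coinvariant_def reducing_def)
qed

end

theorem lemma2p12:
  fixes E :: "('a::cstar_algebra, 'e::{complex_normed_vector,complete_space}) correspondence"
    and S :: "'e \<Rightarrow> 'h::chilbert_space \<Rightarrow> 'h"
    and \<rho> :: "'a \<Rightarrow> 'h \<Rightarrow> 'h"
    and V M :: "'h set"
  assumes "cstar_correspondence E"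
    and "finitely_correlated E S \<rho>"
    and "fully_coisometric E UNIV S \<rho>"
    and "closed_csubspace V"
    and "finite_dim V"
    and "invariant_under (adjoints (wot_algebra S \<rho>)) V"
    and "minimal_isometric_dilation E V (\<lambda>\<xi> h. proj V (S \<xi> h)) \<rho> S \<rho>"
    and "closed_csubspace M"
    and "M \<noteq> {0}"
    and "invariant_under (adjoints (wot_algebra S \<rho>)) M"
  shows "M \<inter> V \<noteq> {0}"
proof -
  have "isometric E UNIV S \<rho>"
    using assms(2) by (simp add: finitely_correlated_def)
  then interpret isometric_representation E S \<rho>
    using assms(1) by (intro isometric_representation.intro isometric_representation_axioms.intro)
  have "(\<Union>n. tilde S ` tensor_space E V \<rho> n) \<subseteq> (\<Union>n. closure (fiber S V n))"
    using tilde_in_closure_fiber by blast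
  then have "closure (cspan (\<Union>n. closure (fiber S V n))) = UNIV"
    using closure_mono[OF cvs.span_mono] assms(7)
    unfolding minimal_isometric_dilation_def by (metis top.extremum_uniqueI)
  then show ?thesis
    using assms by (intro coinvariant_intersection coinvariant_if_adjoints_invariant
        fully_coisometric_total) auto
qed

end
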